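(* For every $m\in\{3,4,5,6,7\}$ there exist integers $d\geq 1$, $k\geq 1$ with $2k+d=m$ and a nearly free conic-line arrangement $\mathcal{C}\subset\mathbb{P}^{2}_{\mathbb{C}}$ consisting of $d$ lines and $k$ smooth conics (so of degree $m$) all of whose singular points are nodes, tacnodes, or ordinary triple points.
   Context: A conic-line arrangement $\mathcal{C}\subset\mathbb{P}^2_{\mathbb{C}}$ with $d$ lines and $k$ smooth conics is the reduced plane curve that is the union of $d$ pairwise distinct lines and $k$ pairwise distinct smooth conics; its degree is $m=2k+d$ and its defining equation is $f=0$, where $f\in S:=\mathbb{C}[x,y,z]$ is the product of the defining forms of all components. A node is an $A_1$ singularity (two smooth branches meeting transversally), a tacnode is an $A_3$ singularity (two smooth branches meeting with intersection multiplicity $2$), and an ordinary triple point is a $D_4$ singularity (three smooth branches with pairwise distinct tangents). It is not required that all three types occur. For a reduced plane curve $C: f=0$ with $f\in S$ homogeneous of degree $m$, let $J_f=\langle \partial_x f,\partial_y f,\partial_z f\rangle$ be the Jacobian ideal, let $I_f$ be the saturation of $J_f$ with respect to $\mathfrak{m}=\langle x,y,z\rangle$, and let $N(f)=I_f/J_f$, a graded $S$-module. The curve $C$ is nearly free if $N(f)\neq 0$ and $\dim_{\mathbb{C}} N(f)_j\leq 1$ for every integer $j$. *)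

theory Defs
  imports
    "HOL-Analysis.Analysis"
    "HOL-Computational_Algebra.Computational_Algebra"
begin

text \<open>The ring \<open>S = \<complex>[x,y,z]\<close> is the iterated polynomial ring \<open>\<complex>[x][y][z]\<close>, the outermost
  variable being \<open>z\<close>. Points of the projective plane are given by nonzero vectors of homogeneous
  coordinates, so a plane curve is the punctured affine cone over it.\<close>

type_synonym poly3 = "complex poly poly poly"
type_synonym germ = "complex fps fps"

definition const3 :: "complex \<Rightarrow> poly3" where
  "const3 c = [:[:[:c:]:]:]"

definition coeff3 :: "poly3 \<Rightarrow> nat \<Rightarrow> nat \<Rightarrow> nat \<Rightarrow> complex" where
  "coeff3 f i j k = coeff (coeff (coeff f k) j) i"

definition dx :: "poly3 \<Rightarrow> poly3" where "dx = map_poly (map_poly pderiv)"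
definition dy :: "poly3 \<Rightarrow> poly3" where "dy = map_poly pderiv"
definition dz :: "poly3 \<Rightarrow> poly3" where "dz = pderiv"

text \<open>Value of \<open>f\<close> at \<open>x = a\<close>, \<open>y = b\<close>, \<open>z = c\<close> in a \<open>\<complex>\<close>-algebra with structure map \<open>\<iota>\<close>.\<close>
definition eval3 :: "(complex \<Rightarrow> 'a::comm_ring_1) \<Rightarrow> poly3 \<Rightarrow> 'a \<Rightarrow> 'a \<Rightarrow> 'a \<Rightarrow> 'a" where
  "eval3 \<iota> f a b c =
     poly (map_poly (\<lambda>g. poly (map_poly (\<lambda>h. poly (map_poly \<iota> h) a) g) b) f) c"

definition value_at :: "poly3 \<Rightarrow> complex^3 \<Rightarrow> complex" where
  "value_at f p = eval3 (\<lambda>c. c) f (p $ 1) (p $ 2) (p $ 3)"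

definition forms :: "nat \<Rightarrow> poly3 set" where
  "forms n = {f. \<forall>i j k. coeff3 f i j k \<noteq> 0 \<longrightarrow> i + j + k = n}"

definition curve :: "poly3 \<Rightarrow> (complex^3) set" where
  "curve f = {p. p \<noteq> 0 \<and> value_at f p = 0}"

definition singular_point :: "poly3 \<Rightarrow> complex^3 \<Rightarrow> bool" where
  "singular_point f p \<longleftrightarrow> p \<in> curve f \<and>
     value_at (dx f) p = 0 \<and> value_at (dy f) p = 0 \<and> value_at (dz f) p = 0"

definition line_form :: "poly3 \<Rightarrow> bool" where
  "line_form f \<longleftrightarrow> f \<noteq> 0 \<and> f \<in> forms 1"

definition smooth_conic_form :: "poly3 \<Rightarrow> bool" where
  "smooth_conic_form f \<longleftrightarrow> f \<noteq> 0 \<and> f \<in> forms 2 \<and> (\<nexists>p. singular_point f p)"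

definition conic_line_arrangement :: "nat \<Rightarrow> nat \<Rightarrow> poly3 \<Rightarrow> bool" where
  "conic_line_arrangement d k f \<longleftrightarrow> (\<exists>L Q :: nat \<Rightarrow> poly3.
     (\<forall>i<d. line_form (L i)) \<and> inj_on (\<lambda>i. curve (L i)) {..<d} \<and>
     (\<forall>j<k. smooth_conic_form (Q j)) \<and> inj_on (\<lambda>j. curve (Q j)) {..<k} \<and>
     f = (\<Prod>i<d. L i) * (\<Prod>j<k. Q j))"

text \<open>The span with respect to ring multiplication is the generated ideal.\<close>
definition ideal_gen :: "'a::comm_ring_1 set \<Rightarrow> 'a set" where
  "ideal_gen A = module.span (*) A"

fun ideal_power :: "'a::comm_ring_1 set \<Rightarrow> nat \<Rightarrow> 'a set" where
  "ideal_power I 0 = UNIV"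
| "ideal_power I (Suc n) = ideal_gen {a * b | a b. a \<in> I \<and> b \<in> ideal_power I n}"

definition saturation :: "'a::comm_ring_1 set \<Rightarrow> 'a set \<Rightarrow> 'a set" where
  "saturation J I = {g. \<exists>n. \<forall>h \<in> ideal_power I n. h * g \<in> J}"

text \<open>For subspaces \<open>W \<subseteq> V\<close> (with scalar multiplication \<open>s\<close>), \<open>dim (V / W) = n\<close>: there are \<open>n\<close>
  elements of \<open>V\<close> whose residue classes form a basis of \<open>V / W\<close>.\<close>
definition has_quotient_dim ::
    "(complex \<Rightarrow> 'a::ab_group_add \<Rightarrow> 'a) \<Rightarrow> 'a set \<Rightarrow> 'a set \<Rightarrow> nat \<Rightarrow> bool" where
  "has_quotient_dim s V W n \<longleftrightarrow> (\<exists>B. finite B \<and> card B = n \<and> B \<subseteq> V \<and>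
     (\<forall>c. (\<Sum>b\<in>B. s (c b) b) \<in> W \<longrightarrow> (\<forall>b\<in>B. c b = 0)) \<and>
     (\<forall>v\<in>V. \<exists>c. v - (\<Sum>b\<in>B. s (c b) b) \<in> W))"

definition irrelevant_ideal :: "poly3 set" where
  "irrelevant_ideal = ideal_gen {[:[:[:0, 1:]:]:], [:[:0, 1:]:], [:0, 1:]}"

definition jacobian_ideal :: "poly3 \<Rightarrow> poly3 set" where
  "jacobian_ideal f = ideal_gen {dx f, dy f, dz f}"

definition saturated_jacobian_ideal :: "poly3 \<Rightarrow> poly3 set" where
  "saturated_jacobian_ideal f = saturation (jacobian_ideal f) irrelevant_ideal"

text \<open>\<open>N(f) = I\<^sub>f / J\<^sub>f\<close> is nonzero, and \<open>N(f)\<^sub>j = (I\<^sub>f \<inter> S\<^sub>j) / (J\<^sub>f \<inter> S\<^sub>j)\<close> has dimension at most one;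
  components in negative degrees vanish.\<close>
definition nearly_free :: "poly3 \<Rightarrow> bool" where
  "nearly_free f \<longleftrightarrow> saturated_jacobian_ideal f \<noteq> jacobian_ideal f \<and>
     (\<forall>j. \<exists>n\<le>1. has_quotient_dim (\<lambda>c g. const3 c * g)
        (saturated_jacobian_ideal f \<inter> forms j) (jacobian_ideal f \<inter> forms j) n)"

text \<open>Germs of plane curves live in \<open>\<complex>[[u,v]]\<close>, realised as \<open>\<complex>[[u]][[v]]\<close>.\<close>

definition germ_const :: "complex \<Rightarrow> germ" where
  "germ_const c = fps_const (fps_const c)"

definition germ_coeff :: "germ \<Rightarrow> nat \<Rightarrow> nat \<Rightarrow> complex" where
  "germ_coeff g i j = fps_nth (fps_nth g j) i"

text \<open>The germ of \<open>f = 0\<close> at \<open>p\<close> in the affine chart \<open>(u,v) \<mapsto> [p + u e\<^sub>1 + v e\<^sub>2]\<close>, where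
  \<open>p, e\<^sub>1, e\<^sub>2\<close> is a basis.\<close>
definition local_germ :: "poly3 \<Rightarrow> complex^3 \<Rightarrow> complex^3 \<Rightarrow> complex^3 \<Rightarrow> germ" where
  "local_germ f p e1 e2 =
     (let u = fps_const fps_X; v = fps_X;
          t = (\<lambda>i. germ_const (p $ i) + germ_const (e1 $ i) * u + germ_const (e2 $ i) * v)
      in eval3 germ_const f (t 1) (t 2) (t 3))"

text \<open>Formal branches are the irreducible factors of the germ in \<open>\<complex>[[u,v]]\<close>. A smooth branch is
  a factor of order one (hence irreducible). Units are absorbed into the factors below.\<close>

definition smooth_branch :: "germ \<Rightarrow> bool" where
  "smooth_branch g \<longleftrightarrow> germ_coeff g 0 0 = 0 \<and> (germ_coeff g 1 0 \<noteq> 0 \<or> germ_coeff g 0 1 \<noteq> 0)"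

definition distinct_tangents :: "germ \<Rightarrow> germ \<Rightarrow> bool" where
  "distinct_tangents g h \<longleftrightarrow>
     germ_coeff g 1 0 * germ_coeff h 0 1 \<noteq> germ_coeff g 0 1 * germ_coeff h 1 0"

definition has_intersection_multiplicity :: "germ \<Rightarrow> germ \<Rightarrow> nat \<Rightarrow> bool" where
  "has_intersection_multiplicity g h n \<longleftrightarrow>
     has_quotient_dim (\<lambda>c g. germ_const c * g) UNIV (ideal_gen {g, h}) n"

definition node_germ :: "germ \<Rightarrow> bool" where
  "node_germ F \<longleftrightarrow> (\<exists>g h. F = g * h \<and> smooth_branch g \<and> smooth_branch h \<and> distinct_tangents g h)"

definition tacnode_germ :: "germ \<Rightarrow> bool" where
  "tacnode_germ F \<longleftrightarrow> (\<exists>g h. F = g * h \<and> smooth_branch g \<and> smooth_branch h \<and>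
     has_intersection_multiplicity g h 2)"

definition triple_point_germ :: "germ \<Rightarrow> bool" where
  "triple_point_germ F \<longleftrightarrow> (\<exists>g h l. F = g * h * l \<and>
     smooth_branch g \<and> smooth_branch h \<and> smooth_branch l \<and>
     distinct_tangents g h \<and> distinct_tangents g l \<and> distinct_tangents h l)"

text \<open>A property of the germ at \<open>p\<close>. The properties used here do not depend on the chart or on the
  choice of homogeneous coordinates for \<open>p\<close>.\<close>
definition germ_at :: "(germ \<Rightarrow> bool) \<Rightarrow> poly3 \<Rightarrow> complex^3 \<Rightarrow> bool" where
  "germ_at P f p \<longleftrightarrow> (\<exists>e1 e2. det (vector [p, e1, e2] :: complex^3^3) \<noteq> 0 \<and> P (local_germ f p e1 e2))"

definition node :: "poly3 \<Rightarrow> complex^3 \<Rightarrow> bool" where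
  "node = germ_at node_germ"

definition tacnode :: "poly3 \<Rightarrow> complex^3 \<Rightarrow> bool" where
  "tacnode = germ_at tacnode_germ"

definition ordinary_triple_point :: "poly3 \<Rightarrow> complex^3 \<Rightarrow> bool" where
  "ordinary_triple_point = germ_at triple_point_germ"

end

theory Submission
  imports Defs "HOL-Computational_Algebra.Field_as_Ring"
begin

text \<open>
  Consider the circle \<open>x\<^sup>2 + y\<^sup>2 = z\<^sup>2\<close>, the line at infinity \<open>z = 0\<close> and the sides \<open>x = \<plusminus>z\<close>, \<open>y = \<plusminus>z\<close> of the
  circumscribed square. The circle together with the first \<open>d = m - 2\<close> of the lines
  \<open>z, x - z, y - z, x + z, y + z\<close> is an arrangement of degree \<open>m\<close>. A side touches the circle in a tacnode,
  two opposite sides and the line at infinity may meet in a triple point, and every other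
  singular point is a transversal crossing of two components (lemma \<open>singular_points\<close>).

  Near freeness is certified by a matrix. Let \<open>J\<close> be the Jacobian ideal of \<open>f\<close>. For each of the five
  curves there is a 3x4 matrix with rows \<open>(b\<^sub>i, l\<^sub>i)\<close>, where \<open>b\<^sub>i\<close> is a vector of three forms, whose maximal
  minors are the three partial derivatives of \<open>f\<close>, up to a common constant, and a further form \<open>g\<close>. The rows
  are syzygies of \<open>(f\<^sub>x, f\<^sub>y, f\<^sub>z, g)\<close>, up to the constant, and they generate all syzygies: by Cramer's rule each
  minor times a syzygy is a combination of the rows, and the ideal of minors contains the coprime
  elements \<open>f\<close> and \<open>f\<^sub>z\<close> (lemma \<open>exact\<close>). This has the following consequences for the ideal \<open>I = J + (g)\<close>.

  \<^item> The rows give \<open>l\<^sub>i g \<in> J\<close>, so \<open>I / J\<close> is a quotient of \<open>S / (l\<^sub>1, l\<^sub>2, l\<^sub>3)\<close>. Modulo the \<open>l\<^sub>i\<close> the variables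
    are scalar multiples of one linear form with square zero. Hence \<open>I / J\<close> has dimension at most one in
    each degree, and a power of the irrelevant ideal maps \<open>g\<close> into \<open>J\<close>.
  \<^item> The form \<open>g\<close> is not in \<open>J\<close>, since the last entry of every syzygy vanishes at the origin
    (lemma \<open>p4_notin_J\<close>).
  \<^item> The ideal \<open>I\<close> is saturated, because the matrix has rank three at the point \<open>(0:0:1)\<close>, which is not
    on the curve (lemma \<open>colon_I\<close>).

  So \<open>I\<close> is the saturation of \<open>J\<close>, and \<open>N(f) = I / J\<close> is nonzero with components of dimension at most one.
\<close>

section \<open>Evaluation homomorphisms and partial derivatives\<close>

definition is_ring_hom :: "('a::comm_ring_1 \<Rightarrow> 'b::comm_ring_1) \<Rightarrow> bool" where
  "is_ring_hom \<phi> \<longleftrightarrow> \<phi> 1 = 1 \<and> (\<forall>a b. \<phi> (a + b) = \<phi> a + \<phi> b) \<and> (\<forall>a b. \<phi> (a * b) = \<phi> a * \<phi> b)"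

lemma ring_hom_simps:
  assumes "is_ring_hom \<phi>"
  shows ring_hom_0: "\<phi> 0 = 0" and ring_hom_1: "\<phi> 1 = 1"
    and ring_hom_add: "\<phi> (a + b) = \<phi> a + \<phi> b"
    and ring_hom_mult: "\<phi> (a * b) = \<phi> a * \<phi> b"
    and ring_hom_minus: "\<phi> (- a) = - \<phi> a"
    and ring_hom_diff: "\<phi> (a - b) = \<phi> a - \<phi> b"
    and ring_hom_numeral: "\<phi> (numeral n) = numeral n"
    and ring_hom_power: "\<phi> (a ^ k) = \<phi> a ^ k"
    and ring_hom_sum: "\<phi> (sum h A) = (\<Sum>i\<in>A. \<phi> (h i))"
    and ring_hom_prod: "\<phi> (prod h A) = (\<Prod>i\<in>A. \<phi> (h i))"
proof -
  have one: "\<phi> 1 = 1" and add: "\<phi> (a + b) = \<phi> a + \<phi> b" and mult: "\<phi> (a * b) = \<phi> a * \<phi> b" for a b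
    using assms by (auto simp: is_ring_hom_def)
  show 0: "\<phi> 0 = 0" using add[of 0 0] by simp
  show "\<phi> 1 = 1" "\<phi> (a + b) = \<phi> a + \<phi> b" "\<phi> (a * b) = \<phi> a * \<phi> b" by (fact one add mult)+
  show minus: "\<phi> (- a) = - \<phi> a" for a using add[of a "- a"] 0 by (simp add: eq_neg_iff_add_eq_0 add.commute)
  show "\<phi> (a - b) = \<phi> a - \<phi> b" using add[of a "- b"] minus[of b] by simp
  show "\<phi> (numeral n) = numeral n" by (induction n) (simp_all only: numeral.simps one add)
  show "\<phi> (a ^ k) = \<phi> a ^ k" by (induction k) (simp_all add: one mult)
  show "\<phi> (sum h A) = (\<Sum>i\<in>A. \<phi> (h i))" by (induction A rule: infinite_finite_induct) (simp_all add: 0 add)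
  show "\<phi> (prod h A) = (\<Prod>i\<in>A. \<phi> (h i))" by (induction A rule: infinite_finite_induct) (simp_all add: one mult)
qed

lemma ring_hom_poly_map_poly:
  assumes \<phi>: "is_ring_hom \<phi>"
  shows "is_ring_hom (\<lambda>p. poly (map_poly \<phi> p) c)"
proof -
  note [simp] = ring_hom_simps[OF \<phi>] map_poly_pCons[of \<phi>]
  have add: "map_poly \<phi> (p + q) = map_poly \<phi> p + map_poly \<phi> q" for p q
    by (rule poly_eqI) (simp add: coeff_map_poly)
  have smult: "map_poly \<phi> (smult a q) = smult (\<phi> a) (map_poly \<phi> q)" for a q
    by (rule poly_eqI) (simp add: coeff_map_poly)
  have mult: "map_poly \<phi> (p * q) = map_poly \<phi> p * map_poly \<phi> q" for p q
    by (induction p) (simp_all add: add smult)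
  show ?thesis by (simp add: is_ring_hom_def add mult)
qed

lemma ring_hom_eval3: "is_ring_hom \<iota> \<Longrightarrow> is_ring_hom (\<lambda>f. eval3 \<iota> f a b c)"
  unfolding eval3_def by (intro ring_hom_poly_map_poly)

definition X :: poly3 where "X = [:[:[:0, 1:]:]:]"
definition Y :: poly3 where "Y = [:[:0, 1:]:]"
definition Z :: poly3 where "Z = [:0, 1:]"

lemma eval3_simps:
  assumes "is_ring_hom \<iota>"
  shows eval3_X: "eval3 \<iota> X a b c = a"
    and eval3_Y: "eval3 \<iota> Y a b c = b"
    and eval3_Z: "eval3 \<iota> Z a b c = c"
    and eval3_const3: "eval3 \<iota> (const3 \<gamma>) a b c = \<iota> \<gamma>"
proof -
  note [simp] = ring_hom_0[OF assms] ring_hom_1[OF assms]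
  show "eval3 \<iota> X a b c = a" "eval3 \<iota> Y a b c = b" "eval3 \<iota> Z a b c = c" "eval3 \<iota> (const3 \<gamma>) a b c = \<iota> \<gamma>"
    by (simp_all add: eval3_def X_def Y_def Z_def const3_def map_poly_pCons)
qed

lemma ring_hom_const3: "is_ring_hom const3"
  by (simp add: is_ring_hom_def const3_def one_pCons)

lemma ring_hom_value_at: "is_ring_hom (\<lambda>f. value_at f p)"
  unfolding value_at_def by (rule ring_hom_eval3) (simp add: is_ring_hom_def)

lemma value_at_XYZ [simp]:
  "value_at X p = p $ 1" "value_at Y p = p $ 2" "value_at Z p = p $ 3" "value_at (const3 c) p = c"
  unfolding value_at_def by (rule eval3_simps, simp add: is_ring_hom_def)+

lemmas value_at_simps [simp] = ring_hom_simps[OF ring_hom_value_at]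

definition derivation :: "('a::comm_ring_1 \<Rightarrow> 'a) \<Rightarrow> bool" where
  "derivation \<delta> \<longleftrightarrow> (\<forall>a b. \<delta> (a + b) = \<delta> a + \<delta> b) \<and> (\<forall>a b. \<delta> (a * b) = \<delta> a * b + a * \<delta> b)"

lemma derivation_simps:
  assumes "derivation \<delta>"
  shows derivation_0: "\<delta> 0 = 0" and derivation_1: "\<delta> 1 = 0"
    and derivation_add: "\<delta> (a + b) = \<delta> a + \<delta> b"
    and derivation_mult: "\<delta> (a * b) = \<delta> a * b + a * \<delta> b"
    and derivation_minus: "\<delta> (- a) = - \<delta> a"
    and derivation_diff: "\<delta> (a - b) = \<delta> a - \<delta> b"
proof -
  have add: "\<delta> (a + b) = \<delta> a + \<delta> b" and mult: "\<delta> (a * b) = \<delta> a * b + a * \<delta> b" for a b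
    using assms by (auto simp: derivation_def)
  show 0: "\<delta> 0 = 0" using add[of 0 0] by simp
  show "\<delta> 1 = 0" using mult[of 1 1] by simp
  show "\<delta> (a + b) = \<delta> a + \<delta> b" "\<delta> (a * b) = \<delta> a * b + a * \<delta> b" by (fact add mult)+
  show minus: "\<delta> (- a) = - \<delta> a" for a using add[of a "- a"] 0 by (simp add: eq_neg_iff_add_eq_0 add.commute)
  show "\<delta> (a - b) = \<delta> a - \<delta> b" using add[of a "- b"] minus[of b] by simp
qed

text \<open>Differentiating coefficientwise is again a derivation, which yields the product rule for the partial
  derivatives with respect to the inner variables.\<close>
lemma derivation_map_poly:
  assumes "derivation \<delta>"
  shows "derivation (map_poly \<delta>)"
proof -
  note [simp] = derivation_simps[OF assms]
  have sum: "\<delta> (sum h A) = (\<Sum>i\<in>A. \<delta> (h i))" for h :: "nat \<Rightarrow> 'a" and A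
    by (induction A rule: infinite_finite_induct) simp_all
  show ?thesis unfolding derivation_def
    by (auto intro!: poly_eqI simp: coeff_map_poly coeff_mult sum sum.distrib)
qed

lemma derivation_pderiv: "derivation (pderiv :: 'a::idom poly \<Rightarrow> _)"
  by (simp add: derivation_def pderiv_add pderiv_mult algebra_simps)

lemma derivation_partials: "derivation dx" "derivation dy" "derivation dz"
  unfolding dx_def dy_def dz_def by (intro derivation_map_poly derivation_pderiv)+

lemmas partials_simps [simp] = derivation_partials[THEN derivation_0] derivation_partials[THEN derivation_1]
  derivation_partials[THEN derivation_add] derivation_partials[THEN derivation_mult]
  derivation_partials[THEN derivation_minus] derivation_partials[THEN derivation_diff]

lemma partials_XYZ [simp]:
  "dx X = 1" "dx Y = 0" "dx Z = 0" "dy X = 0" "dy Y = 1" "dy Z = 0" "dz X = 0" "dz Y = 0" "dz Z = 1"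
  by (simp_all add: X_def Y_def Z_def dx_def dy_def dz_def map_poly_pCons pderiv_pCons one_pCons)

lemma derivation_numeral:
  assumes "derivation \<delta>"
  shows "\<delta> (numeral n) = 0"
  by (induction n) (simp_all only: numeral.simps derivation_simps[OF assms] add_0)

lemmas partials_numeral [simp] = derivation_partials[THEN derivation_numeral]

section \<open>Ideals\<close>

lemma module_times: "module ((*) :: 'a::comm_ring_1 \<Rightarrow> 'a \<Rightarrow> 'a)"
  by unfold_locales (simp_all add: algebra_simps)

lemma in_ideal_gen2: "x \<in> ideal_gen {a, b} \<longleftrightarrow> (\<exists>r s. x = r * a + s * b)"
  unfolding ideal_gen_def module.span_breakdown_eq[OF module_times] module.span_empty[OF module_times]
  by (auto simp: algebra_simps)

lemma in_ideal_gen3: "x \<in> ideal_gen {a, b, c} \<longleftrightarrow> (\<exists>r s t. x = r * a + s * b + t * c)"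
  unfolding ideal_gen_def module.span_breakdown_eq[OF module_times] module.span_empty[OF module_times]
  by (auto simp: algebra_simps)

lemma ideal_gen_base: "a \<in> A \<Longrightarrow> a \<in> ideal_gen A"
  unfolding ideal_gen_def by (rule module.span_base[OF module_times])

lemma ideal_gen_0: "0 \<in> ideal_gen A"
  unfolding ideal_gen_def by (rule module.span_zero[OF module_times])

lemma ideal_gen_add: "a \<in> ideal_gen A \<Longrightarrow> b \<in> ideal_gen A \<Longrightarrow> a + b \<in> ideal_gen A"
  unfolding ideal_gen_def by (rule module.span_add[OF module_times])

lemma ideal_gen_diff: "a \<in> ideal_gen A \<Longrightarrow> b \<in> ideal_gen A \<Longrightarrow> a - b \<in> ideal_gen A"
  unfolding ideal_gen_def by (rule module.span_diff[OF module_times])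

lemma ideal_gen_mult: "a \<in> ideal_gen A \<Longrightarrow> r * a \<in> ideal_gen A"
  unfolding ideal_gen_def by (rule module.span_scale[OF module_times])

lemma ideal_gen_sum: "(\<And>i. i \<in> I \<Longrightarrow> h i \<in> ideal_gen A) \<Longrightarrow> sum h I \<in> ideal_gen A"
  unfolding ideal_gen_def by (rule module.span_sum[OF module_times])

lemma ideal_gen_subset: "A \<subseteq> ideal_gen B \<Longrightarrow> ideal_gen A \<subseteq> ideal_gen B"
  unfolding ideal_gen_def by (metis module.span_minimal module.subspace_span module_times)

lemma irrelevant_ideal_eq: "irrelevant_ideal = ideal_gen {X, Y, Z}"
  by (simp add: irrelevant_ideal_def X_def Y_def Z_def)

section \<open>Exactness for the maximal minors of a 3x4 matrix\<close>

text \<open>Cramer's rule with right-hand side \<open>s\<close>: the three coordinates are solved for in the columns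
  \<open>a, b, c\<close>, and the syzygy condition, expanded along the column \<open>d\<close>, yields the fourth equation.\<close>
lemma cramer_syzygy:
  fixes a1 a2 a3 b1 b2 b3 c1 c2 c3 d1 d2 d3 :: "'a::comm_ring_1"
  assumes pa: "pa = d1 * (b2 * c3 - c2 * b3) + d2 * (b3 * c1 - c3 * b1) + d3 * (b1 * c2 - c1 * b2)"
    and pb: "pb = d1 * (c2 * a3 - a2 * c3) + d2 * (c3 * a1 - a3 * c1) + d3 * (c1 * a2 - a1 * c2)"
    and pc: "pc = d1 * (a2 * b3 - b2 * a3) + d2 * (a3 * b1 - b3 * a1) + d3 * (a1 * b2 - b1 * a2)"
    and pd: "pd = - (a1 * (b2 * c3 - c2 * b3) + a2 * (b3 * c1 - c3 * b1) + a3 * (b1 * c2 - c1 * b2))"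
    and syz: "sa * pa + sb * pb + sc * pc + sd * pd = 0"
  shows "\<exists>w1 w2 w3. pd * sa = w1 * a1 + w2 * a2 + w3 * a3 \<and> pd * sb = w1 * b1 + w2 * b2 + w3 * b3 \<and>
    pd * sc = w1 * c1 + w2 * c2 + w3 * c3 \<and> pd * sd = w1 * d1 + w2 * d2 + w3 * d3"
proof (intro exI conjI)
  let ?w1 = "- (sa * (b2 * c3 - c2 * b3) + sb * (c2 * a3 - a2 * c3) + sc * (a2 * b3 - b2 * a3))"
  let ?w2 = "- (sa * (b3 * c1 - c3 * b1) + sb * (c3 * a1 - a3 * c1) + sc * (a3 * b1 - b3 * a1))"
  let ?w3 = "- (sa * (b1 * c2 - c1 * b2) + sb * (c1 * a2 - a1 * c2) + sc * (a1 * b2 - b1 * a2))"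
  show "pd * sa = ?w1 * a1 + ?w2 * a2 + ?w3 * a3" unfolding pd by (simp add: algebra_simps)
  show "pd * sb = ?w1 * b1 + ?w2 * b2 + ?w3 * b3" unfolding pd by (simp add: algebra_simps)
  show "pd * sc = ?w1 * c1 + ?w2 * c2 + ?w3 * c3" unfolding pd by (simp add: algebra_simps)
  have "?w1 * d1 + ?w2 * d2 + ?w3 * d3 = - (sa * pa + sb * pb + sc * pc)"
    unfolding pa pb pc by (simp add: algebra_simps)
  also have "\<dots> = pd * sd" using syz by (simp add: algebra_simps neg_eq_iff_add_eq_0)
  finally show "pd * sd = ?w1 * d1 + ?w2 * d2 + ?w3 * d3" ..
qed

text \<open>The rows are \<open>(b\<^sub>i\<^sub>1, b\<^sub>i\<^sub>2, b\<^sub>i\<^sub>3, l\<^sub>i)\<close> and \<open>p\<^sub>j\<close> is the signed minor without the \<open>j\<close>-th column. In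
  vector notation \<open>(p\<^sub>1, p\<^sub>2, p\<^sub>3) = l\<^sub>1 (b\<^sub>2 \<times> b\<^sub>3) + l\<^sub>2 (b\<^sub>3 \<times> b\<^sub>1) + l\<^sub>3 (b\<^sub>1 \<times> b\<^sub>2)\<close> and
  \<open>p\<^sub>4 = - det (b\<^sub>1, b\<^sub>2, b\<^sub>3)\<close>.\<close>
locale minors_3x4 =
  fixes b11 b12 b13 l1 b21 b22 b23 l2 b31 b32 b33 l3 p1 p2 p3 p4 :: "'a::comm_ring_1"
  assumes p1: "p1 = l1 * (b22 * b33 - b23 * b32) + l2 * (b32 * b13 - b33 * b12) + l3 * (b12 * b23 - b13 * b22)"
    and p2: "p2 = l1 * (b23 * b31 - b21 * b33) + l2 * (b33 * b11 - b31 * b13) + l3 * (b13 * b21 - b11 * b23)"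
    and p3: "p3 = l1 * (b21 * b32 - b22 * b31) + l2 * (b31 * b12 - b32 * b11) + l3 * (b11 * b22 - b12 * b21)"
    and p4: "p4 = - (b11 * (b22 * b33 - b23 * b32) + b21 * (b32 * b13 - b33 * b12) + b31 * (b12 * b23 - b13 * b22))"
begin

lemma rows_are_syzygies:
  "b11 * p1 + b12 * p2 + b13 * p3 + l1 * p4 = 0"
  "b21 * p1 + b22 * p2 + b23 * p3 + l2 * p4 = 0"
  "b31 * p1 + b32 * p2 + b33 * p3 + l3 * p4 = 0"
  unfolding p1 p2 p3 p4 by (simp_all add: algebra_simps)

definition in_row_span :: "'a \<Rightarrow> 'a \<Rightarrow> 'a \<Rightarrow> 'a \<Rightarrow> bool" where
  "in_row_span s1 s2 s3 s4 \<longleftrightarrow> (\<exists>w1 w2 w3.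
     s1 = w1 * b11 + w2 * b21 + w3 * b31 \<and> s2 = w1 * b12 + w2 * b22 + w3 * b32 \<and>
     s3 = w1 * b13 + w2 * b23 + w3 * b33 \<and> s4 = w1 * l1 + w2 * l2 + w3 * l3)"

lemma in_row_span_add:
  assumes "in_row_span s1 s2 s3 s4" and "in_row_span t1 t2 t3 t4"
  shows "in_row_span (s1 + t1) (s2 + t2) (s3 + t3) (s4 + t4)"
proof -
  obtain v1 v2 v3 w1 w2 w3 where
    "s1 = v1 * b11 + v2 * b21 + v3 * b31" "s2 = v1 * b12 + v2 * b22 + v3 * b32"
    "s3 = v1 * b13 + v2 * b23 + v3 * b33" "s4 = v1 * l1 + v2 * l2 + v3 * l3"
    "t1 = w1 * b11 + w2 * b21 + w3 * b31" "t2 = w1 * b12 + w2 * b22 + w3 * b32"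
    "t3 = w1 * b13 + w2 * b23 + w3 * b33" "t4 = w1 * l1 + w2 * l2 + w3 * l3"
    using assms unfolding in_row_span_def by blast
  then show ?thesis unfolding in_row_span_def
    by (intro exI[of _ "v1 + w1"] exI[of _ "v2 + w2"] exI[of _ "v3 + w3"]) (simp add: algebra_simps)
qed

lemma in_row_span_scale:
  assumes "in_row_span s1 s2 s3 s4"
  shows "in_row_span (r * s1) (r * s2) (r * s3) (r * s4)"
proof -
  obtain v1 v2 v3 where
    "s1 = v1 * b11 + v2 * b21 + v3 * b31" "s2 = v1 * b12 + v2 * b22 + v3 * b32"
    "s3 = v1 * b13 + v2 * b23 + v3 * b33" "s4 = v1 * l1 + v2 * l2 + v3 * l3"
    using assms unfolding in_row_span_def by blast
  then show ?thesis unfolding in_row_span_def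
    by (intro exI[of _ "r * v1"] exI[of _ "r * v2"] exI[of _ "r * v3"]) (simp add: algebra_simps)
qed

text \<open>The other minors reduce to the case of \<open>p\<^sub>4\<close> by even permutations of the columns, which preserve
  the signs of the minors.\<close>
lemma minor_times_syzygy:
  assumes syz: "s1 * p1 + s2 * p2 + s3 * p3 + s4 * p4 = 0" and q: "q \<in> {p1, p2, p3, p4}"
  shows "in_row_span (q * s1) (q * s2) (q * s3) (q * s4)"
proof -
  have "in_row_span (p4 * s1) (p4 * s2) (p4 * s3) (p4 * s4)"
    using cramer_syzygy[OF p1 p2 p3 p4 syz] unfolding in_row_span_def .
  moreover have "\<exists>w1 w2 w3. p1 * s4 = w1 * l1 + w2 * l2 + w3 * l3 \<and>
    p1 * s3 = w1 * b13 + w2 * b23 + w3 * b33 \<and>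
    p1 * s2 = w1 * b12 + w2 * b22 + w3 * b32 \<and>
    p1 * s1 = w1 * b11 + w2 * b21 + w3 * b31"
    by (rule cramer_syzygy[where pa = p4 and pb = p3 and pc = p2],
      simp add: p4 algebra_simps, simp add: p3 algebra_simps, simp add: p2 algebra_simps, simp add: p1 algebra_simps,
      use syz in \<open>simp add: algebra_simps\<close>)
  then have "in_row_span (p1 * s1) (p1 * s2) (p1 * s3) (p1 * s4)"
    unfolding in_row_span_def by blast
  moreover have "\<exists>w1 w2 w3. p2 * s3 = w1 * b13 + w2 * b23 + w3 * b33 \<and>
    p2 * s4 = w1 * l1 + w2 * l2 + w3 * l3 \<and>
    p2 * s1 = w1 * b11 + w2 * b21 + w3 * b31 \<and>
    p2 * s2 = w1 * b12 + w2 * b22 + w3 * b32"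
    by (rule cramer_syzygy[where pa = p3 and pb = p4 and pc = p1],
      simp add: p3 algebra_simps, simp add: p4 algebra_simps, simp add: p1 algebra_simps, simp add: p2 algebra_simps,
      use syz in \<open>simp add: algebra_simps\<close>)
  then have "in_row_span (p2 * s1) (p2 * s2) (p2 * s3) (p2 * s4)"
    unfolding in_row_span_def by blast
  moreover have "\<exists>w1 w2 w3. p3 * s2 = w1 * b12 + w2 * b22 + w3 * b32 \<and>
    p3 * s1 = w1 * b11 + w2 * b21 + w3 * b31 \<and>
    p3 * s4 = w1 * l1 + w2 * l2 + w3 * l3 \<and>
    p3 * s3 = w1 * b13 + w2 * b23 + w3 * b33"
    by (rule cramer_syzygy[where pa = p2 and pb = p1 and pc = p4],
      simp add: p2 algebra_simps, simp add: p1 algebra_simps, simp add: p4 algebra_simps, simp add: p3 algebra_simps,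
      use syz in \<open>simp add: algebra_simps\<close>)
  then have "in_row_span (p3 * s1) (p3 * s2) (p3 * s3) (p3 * s4)"
    unfolding in_row_span_def by blast
  ultimately show ?thesis using q by auto
qed

lemma combination_times_syzygy:
  assumes syz: "s1 * p1 + s2 * p2 + s3 * p3 + s4 * p4 = 0"
    and h: "h = c1 * p1 + c2 * p2 + c3 * p3 + c4 * p4"
  shows "in_row_span (h * s1) (h * s2) (h * s3) (h * s4)"
proof -
  have "in_row_span (c * (q * s1)) (c * (q * s2)) (c * (q * s3)) (c * (q * s4))" if "q \<in> {p1, p2, p3, p4}" for c q
    by (rule in_row_span_scale[OF minor_times_syzygy[OF syz that]])
  from in_row_span_add[OF in_row_span_add[OF in_row_span_add[OF this[of p1 c1] this[of p2 c2]] this[of p3 c3]] this[of p4 c4]]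
  show ?thesis by (simp add: h distrib_right mult.assoc)
qed

text \<open>The rows are independent as soon as one minor, here \<open>p\<^sub>3\<close>, is a nonzerodivisor.\<close>
lemma minor_times_dependency:
  assumes "w1 * b11 + w2 * b21 + w3 * b31 = 0" "w1 * b12 + w2 * b22 + w3 * b32 = 0"
    "w1 * l1 + w2 * l2 + w3 * l3 = 0"
  shows "p3 * w1 = 0" "p3 * w2 = 0" "p3 * w3 = 0"
proof -
  have "p3 * w1 = (w1 * b11 + w2 * b21 + w3 * b31) * (l3 * b22 - l2 * b32)
     + (w1 * b12 + w2 * b22 + w3 * b32) * (l2 * b31 - l3 * b21)
     + (w1 * l1 + w2 * l2 + w3 * l3) * (b21 * b32 - b22 * b31)"
    unfolding p3 by (simp add: algebra_simps)
  then show "p3 * w1 = 0" using assms by simp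
  have "p3 * w2 = (w1 * b11 + w2 * b21 + w3 * b31) * (l1 * b32 - l3 * b12)
     + (w1 * b12 + w2 * b22 + w3 * b32) * (l3 * b11 - l1 * b31)
     + (w1 * l1 + w2 * l2 + w3 * l3) * (b31 * b12 - b32 * b11)"
    unfolding p3 by (simp add: algebra_simps)
  then show "p3 * w2 = 0" using assms by simp
  have "p3 * w3 = (w1 * b11 + w2 * b21 + w3 * b31) * (l2 * b12 - l1 * b22)
     + (w1 * b12 + w2 * b22 + w3 * b32) * (l1 * b21 - l2 * b11)
     + (w1 * l1 + w2 * l2 + w3 * l3) * (b11 * b22 - b12 * b21)"
    unfolding p3 by (simp add: algebra_simps)
  then show "p3 * w3 = 0" using assms by simp
qed

end

locale hilbert_burch = minors_3x4 b11 b12 b13 l1 b21 b22 b23 l2 b31 b32 b33 l3 p1 p2 p3 p4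
  for b11 b12 b13 l1 b21 b22 b23 l2 b31 b32 b33 l3 p1 p2 p3 p4 :: "'a::{idom, semiring_gcd}" +
  fixes h
  assumes h: "h \<in> ideal_gen {p1, p2, p3}" and h_coprime: "coprime h p3" and p3_nz: "p3 \<noteq> 0" and h_nz: "h \<noteq> 0"
begin

text \<open>The exactness part of the Hilbert-Burch theorem. Both \<open>h s\<close> and \<open>p\<^sub>3 s\<close> are combinations of the rows,
  with coefficients \<open>v\<close> and \<open>u\<close>. Independence of the rows gives \<open>p\<^sub>3 v = h u\<close>, so that coprimality of \<open>h\<close> and
  \<open>p\<^sub>3\<close> allows the division of \<open>v\<close> by \<open>h\<close>.\<close>
lemma exact:
  assumes syz: "s1 * p1 + s2 * p2 + s3 * p3 + s4 * p4 = 0"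
  shows "in_row_span s1 s2 s3 s4"
proof -
  obtain c1 c2 c3 where hc: "h = c1 * p1 + c2 * p2 + c3 * p3 + 0 * p4"
    using h by (auto simp: in_ideal_gen3)
  obtain v1 v2 v3 where v:
    "h * s1 = v1 * b11 + v2 * b21 + v3 * b31" "h * s2 = v1 * b12 + v2 * b22 + v3 * b32"
    "h * s3 = v1 * b13 + v2 * b23 + v3 * b33" "h * s4 = v1 * l1 + v2 * l2 + v3 * l3"
    using combination_times_syzygy[OF syz hc] unfolding in_row_span_def by blast
  obtain u1 u2 u3 where u:
    "p3 * s1 = u1 * b11 + u2 * b21 + u3 * b31" "p3 * s2 = u1 * b12 + u2 * b22 + u3 * b32"
    "p3 * s3 = u1 * b13 + u2 * b23 + u3 * b33" "p3 * s4 = u1 * l1 + u2 * l2 + u3 * l3"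
    using minor_times_syzygy[OF syz, of p3] unfolding in_row_span_def by blast
  let ?w1 = "p3 * v1 - h * u1" and ?w2 = "p3 * v2 - h * u2" and ?w3 = "p3 * v3 - h * u3"
  have dep: "?w1 * a1 + ?w2 * a2 + ?w3 * a3 = 0"
    if "h * s = v1 * a1 + v2 * a2 + v3 * a3" "p3 * s = u1 * a1 + u2 * a2 + u3 * a3" for s a1 a2 a3
  proof -
    have "?w1 * a1 + ?w2 * a2 + ?w3 * a3 = p3 * (h * s) - h * (p3 * s)"
      unfolding that by (simp add: algebra_simps)
    then show ?thesis by simp
  qed
  have eq: "x = y" if "p3 * (x - y) = 0" for x y
    using that p3_nz by simp
  note dependency = minor_times_dependency[OF dep[OF v(1) u(1)] dep[OF v(2) u(2)] dep[OF v(4) u(4)]]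
  have "p3 * v1 = h * u1" "p3 * v2 = h * u2" "p3 * v3 = h * u3"
    by (rule eq, rule dependency)+
  then have "h dvd p3 * v1" "h dvd p3 * v2" "h dvd p3 * v3" by (metis dvd_triv_left)+
  then have "h dvd v1" "h dvd v2" "h dvd v3"
    using coprime_dvd_mult_right_iff[OF h_coprime] by blast+
  then obtain w1 w2 w3 where w: "v1 = h * w1" "v2 = h * w2" "v3 = h * w3" by (auto elim!: dvdE)
  have cancel: "s = w1 * a1 + w2 * a2 + w3 * a3" if "h * s = v1 * a1 + v2 * a2 + v3 * a3" for s a1 a2 a3
  proof -
    have "h * s = h * (w1 * a1 + w2 * a2 + w3 * a3)" using that by (simp add: w algebra_simps)
    then show ?thesis using h_nz by simp
  qed
  show ?thesis unfolding in_row_span_def using v[THEN cancel] by blast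
qed

end

section \<open>Homogeneous forms\<close>

lemma forms_zero: "0 \<in> forms n"
  by (simp add: forms_def coeff3_def)

lemma forms_add: "f \<in> forms n \<Longrightarrow> g \<in> forms n \<Longrightarrow> f + g \<in> forms n"
  unfolding forms_def coeff3_def by (auto, metis add.right_neutral)

lemma forms_minus: "f \<in> forms n \<Longrightarrow> - f \<in> forms n"
  unfolding forms_def coeff3_def by simp

lemma forms_diff: "f \<in> forms n \<Longrightarrow> g \<in> forms n \<Longrightarrow> f - g \<in> forms n"
  using forms_add[OF _ forms_minus] by force

lemma forms_mult:
  assumes f: "f \<in> forms a" and g: "g \<in> forms b" and n: "n = a + b"
  shows "f * g \<in> forms n"
proof -
  have "i + j + k = a + b" if nz: "coeff3 (f * g) i j k \<noteq> 0" for i j k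
  proof -
    have "coeff3 (f * g) i j k = (\<Sum>k'\<le>k. \<Sum>j'\<le>j. \<Sum>i'\<le>i. coeff3 f i' j' k' * coeff3 g (i - i') (j - j') (k - k'))"
      by (simp add: coeff3_def coeff_mult coeff_sum)
    then obtain i' j' k' where le: "k' \<le> k" "j' \<le> j" "i' \<le> i"
      and "coeff3 f i' j' k' * coeff3 g (i - i') (j - j') (k - k') \<noteq> 0"
      using nz by (auto elim!: sum.not_neutral_contains_not_neutral)
    then have "coeff3 f i' j' k' \<noteq> 0" "coeff3 g (i - i') (j - j') (k - k') \<noteq> 0" by auto
    then have "i' + j' + k' = a" "(i - i') + (j - j') + (k - k') = b"
      using f g unfolding forms_def by blast+
    then show ?thesis using le by linarith
  qed
  then show ?thesis by (simp add: forms_def n)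
qed

lemma forms_const3: "const3 c \<in> forms 0"
  by (auto simp: forms_def coeff3_def const3_def coeff_pCons split: nat.splits)

lemma const3_of_nat: "of_nat n = const3 (of_nat n)"
  using ring_hom_1[OF ring_hom_const3] ring_hom_add[OF ring_hom_const3] ring_hom_0[OF ring_hom_const3]
  by (induction n) simp_all

lemma forms_numeral: "numeral n \<in> forms 0"
  using forms_const3[of "of_nat (numeral n)"] const3_of_nat[of "numeral n"] by simp

lemma forms_XYZ: "X \<in> forms 1" "Y \<in> forms 1" "Z \<in> forms 1"
  by (auto simp: forms_def coeff3_def X_def Y_def Z_def coeff_pCons split: nat.splits)

lemma forms_scale: "f \<in> forms n \<Longrightarrow> const3 c * f \<in> forms n"
  by (rule forms_mult[OF forms_const3]) simp_all

lemma monom_eq: "const3 c * X ^ i * Y ^ j * Z ^ k = monom (monom (monom c i) j) k"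
proof -
  have eqs: "X = monom (monom (monom 1 1) 0) 0" "Y = monom (monom 1 1) 0" "Z = monom 1 1"
    "const3 c = monom (monom (monom c 0) 0) 0"
    by (simp_all add: X_def Y_def Z_def const3_def monom_Suc monom_0 one_pCons)
  show ?thesis unfolding eqs monom_power mult_monom by simp
qed

lemma monomial_expansion:
  "f = (\<Sum>k\<le>degree f. \<Sum>j\<le>degree (coeff f k). \<Sum>i\<le>degree (coeff (coeff f k) j).
     const3 (coeff3 f i j k) * X ^ i * Y ^ j * Z ^ k)"
  by (simp add: monom_eq coeff3_def poly_as_sum_of_monoms flip: monom_sum)

text \<open>The substitution \<open>(x, y, z) \<mapsto> (t x, t y, t z)\<close>. Since it is a ring homomorphism, taking the coefficient
  of \<open>t\<^sup>n\<close> gives homogeneous components that behave well under products.\<close>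
definition grading :: "poly3 \<Rightarrow> poly3 poly" where
  "grading f = eval3 (\<lambda>c. [:const3 c:]) f (monom X 1) (monom Y 1) (monom Z 1)"

definition hcomp :: "nat \<Rightarrow> poly3 \<Rightarrow> poly3" where
  "hcomp n f = coeff (grading f) n"

lemma ring_hom_constant: "is_ring_hom (\<lambda>c. [:const3 c:])"
  using ring_hom_const3 by (simp add: is_ring_hom_def one_pCons)

lemma ring_hom_grading: "is_ring_hom grading"
  unfolding grading_def by (rule ring_hom_eval3[OF ring_hom_constant])

lemma grading_monom: "grading (const3 c * X ^ i * Y ^ j * Z ^ k) = monom (const3 c * X ^ i * Y ^ j * Z ^ k) (i + j + k)"
proof -
  have "grading X = monom X 1" "grading Y = monom Y 1" "grading Z = monom Z 1" "grading (const3 c) = monom (const3 c) 0"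
    unfolding grading_def by (simp_all add: eval3_simps[OF ring_hom_constant] monom_0)
  then show ?thesis
    by (simp add: ring_hom_simps[OF ring_hom_grading] monom_power mult_monom)
qed

lemma hcomp_expansion:
  "hcomp n f = (\<Sum>k\<le>degree f. \<Sum>j\<le>degree (coeff f k). \<Sum>i\<le>degree (coeff (coeff f k) j).
     if i + j + k = n then const3 (coeff3 f i j k) * X ^ i * Y ^ j * Z ^ k else 0)"
  unfolding hcomp_def
  by (subst (1) monomial_expansion[of f])
     (simp add: ring_hom_sum[OF ring_hom_grading] grading_monom coeff_sum)

lemma grading_form:
  assumes "f \<in> forms d"
  shows "grading f = monom f d"
proof (rule poly_eqI)
  fix n
  let ?t = "\<lambda>i j k. const3 (coeff3 f i j k) * X ^ i * Y ^ j * Z ^ k"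
  have "(if i + j + k = n then ?t i j k else 0) = (if n = d then ?t i j k else 0)" for i j k
    using assms by (auto simp: forms_def const3_def)
  then have "coeff (grading f) n = (\<Sum>k\<le>degree f. \<Sum>j\<le>degree (coeff f k).
      \<Sum>i\<le>degree (coeff (coeff f k) j). if n = d then ?t i j k else 0)"
    unfolding hcomp_def[symmetric] hcomp_expansion by simp
  also have "\<dots> = (if n = d then f else 0)"
    using monomial_expansion[of f] by simp
  finally have "coeff (grading f) n = (if n = d then f else 0)" .
  then show "coeff (grading f) n = coeff (monom f d) n" by simp
qed

lemma hcomp_sum: "hcomp n (f + g) = hcomp n f + hcomp n g"
  by (simp add: hcomp_def ring_hom_add[OF ring_hom_grading])

lemma hcomp_form: "f \<in> forms n \<Longrightarrow> hcomp n f = f"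
  by (simp add: hcomp_def grading_form)

lemma hcomp_mult_form:
  assumes "g \<in> forms d"
  shows "hcomp n (f * g) = (if n < d then 0 else hcomp (n - d) f * g)"
proof -
  have "hcomp n (f * g) = coeff (monom g d * grading f) n"
    by (simp add: hcomp_def ring_hom_mult[OF ring_hom_grading] grading_form[OF assms] mult.commute)
  then show ?thesis by (simp only: coeff_monom_mult) (simp add: hcomp_def mult.commute)
qed

lemma poly3_eqI: "(\<And>i j k. coeff3 f i j k = coeff3 g i j k) \<Longrightarrow> f = g"
  by (simp add: coeff3_def poly_eq_iff)

lemma coeff3_partials:
  "coeff3 (dx f) i j k = of_nat (Suc i) * coeff3 f (Suc i) j k"
  "coeff3 (dy f) i j k = of_nat (Suc j) * coeff3 f i (Suc j) k"
  "coeff3 (dz f) i j k = of_nat (Suc k) * coeff3 f i j (Suc k)"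
proof -
  have 1: "coeff (of_nat n * p) l = of_nat n * coeff p l" for n l and p :: "'a::comm_ring_1 poly"
    by (simp add: of_nat_poly)
  show "coeff3 (dx f) i j k = of_nat (Suc i) * coeff3 f (Suc i) j k"
    "coeff3 (dy f) i j k = of_nat (Suc j) * coeff3 f i (Suc j) k"
    "coeff3 (dz f) i j k = of_nat (Suc k) * coeff3 f i j (Suc k)"
    by (simp_all add: coeff3_def dx_def dy_def dz_def coeff_map_poly coeff_pderiv 1 del: of_nat_Suc)
qed

lemma coeff3_times_variable:
  "coeff3 (X * f) i j k = (if i = 0 then 0 else coeff3 f (i - 1) j k)"
  "coeff3 (Y * f) i j k = (if j = 0 then 0 else coeff3 f i (j - 1) k)"
  "coeff3 (Z * f) i j k = (if k = 0 then 0 else coeff3 f i j (k - 1))"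
  by (simp_all add: coeff3_def X_def Y_def Z_def coeff_pCons split: nat.splits)

lemma forms_partials:
  assumes "f \<in> forms (Suc n)"
  shows "dx f \<in> forms n" "dy f \<in> forms n" "dz f \<in> forms n"
proof -
  have "a + b + c = Suc n" if "coeff3 f a b c \<noteq> 0" for a b c
    using assms that by (auto simp: forms_def)
  note degree = this
  show "dx f \<in> forms n" "dy f \<in> forms n" "dz f \<in> forms n"
    by (auto simp: forms_def coeff3_partials simp del: of_nat_Suc dest!: degree)
qed

lemma coeff3_add: "coeff3 (f + g) i j k = coeff3 f i j k + coeff3 g i j k"
  by (simp add: coeff3_def)

lemma coeff3_const3_times: "coeff3 (const3 c * f) i j k = c * coeff3 f i j k"
  by (simp add: coeff3_def const3_def)

lemma euler:
  assumes "f \<in> forms n"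
  shows "const3 (of_nat n) * f = X * dx f + Y * dy f + Z * dz f"
proof (rule poly3_eqI)
  fix i j k
  have "coeff3 (X * dx f + Y * dy f + Z * dz f) i j k = of_nat (i + j + k) * coeff3 f i j k"
    by (simp add: coeff3_add coeff3_times_variable coeff3_partials algebra_simps split: nat.splits)
  also have "\<dots> = of_nat n * coeff3 f i j k"
    using assms by (cases "coeff3 f i j k = 0") (auto simp: forms_def)
  finally show "coeff3 (const3 (of_nat n) * f) i j k = coeff3 (X * dx f + Y * dy f + Z * dz f) i j k"
    by (simp add: coeff3_const3_times)
qed

lemma const3_unit: "c \<noteq> 0 \<Longrightarrow> const3 (inverse c) * const3 c = 1"
  by (simp add: ring_hom_1[OF ring_hom_const3] flip: ring_hom_mult[OF ring_hom_const3])

section \<open>Restriction to the z-axis\<close>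

definition restrict_z_axis :: "poly3 \<Rightarrow> complex poly" where
  "restrict_z_axis f = eval3 (\<lambda>c. [:c:]) f 0 0 [:0, 1:]"

lemma ring_hom_restrict_z_axis: "is_ring_hom restrict_z_axis"
  unfolding restrict_z_axis_def by (rule ring_hom_eval3) (simp add: is_ring_hom_def one_pCons)

lemma restrict_z_axis_XYZ: "restrict_z_axis X = 0" "restrict_z_axis Y = 0" "restrict_z_axis Z = [:0, 1:]"
  unfolding restrict_z_axis_def by (rule eval3_simps, simp add: is_ring_hom_def one_pCons)+

text \<open>The kernel of the restriction is the ideal \<open>(x, y)\<close>. In this form a polynomial that vanishes on the
  axis can be split into multiples of the regular sequence \<open>x, y\<close>.\<close>
lemma restrict_z_axis_eq_0:
  assumes "restrict_z_axis w = 0"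
  shows "\<exists>u v. w = X * u + Y * v"
proof -
  have "\<exists>u v. w = X * u + Y * v + map_poly (\<lambda>c. [:[:c:]:]) (restrict_z_axis w)"
  proof (induction w)
    case 0
    show ?case by (auto simp: ring_hom_0[OF ring_hom_restrict_z_axis] intro!: exI[of _ 0])
  next
    case (pCons g w)
    obtain u v where w: "w = X * u + Y * v + map_poly (\<lambda>c. [:[:c:]:]) (restrict_z_axis w)"
      using pCons by blast
    obtain c g0 g1 where g: "g = pCons (pCons c g0) g1" by (metis pCons_cases)
    have restr: "restrict_z_axis (pCons g w) = pCons c (restrict_z_axis w)"
      by (simp add: g restrict_z_axis_def eval3_def map_poly_pCons)
    have "pCons g w = [:g:] + Z * w" by (simp add: Z_def)
    also have "[:g:] = X * [:[:g0:]:] + Y * [:g1:] + [:[:[:c:]:]:]"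
      by (simp add: g X_def Y_def)
    also have "\<dots> + Z * w = X * ([:[:g0:]:] + Z * u) + Y * ([:g1:] + Z * v) +
       ([:[:[:c:]:]:] + Z * map_poly (\<lambda>c. [:[:c:]:]) (restrict_z_axis w))"
      by (subst w) (simp add: algebra_simps)
    also have "[:[:[:c:]:]:] + Z * map_poly (\<lambda>c. [:[:c:]:]) (restrict_z_axis w) =
       map_poly (\<lambda>c. [:[:c:]:]) (restrict_z_axis (pCons g w))"
      by (simp add: restr Z_def map_poly_pCons)
    finally show ?case by blast
  qed
  then show ?thesis using assms by simp
qed

lemma prime_X: "prime_elem X"
  unfolding X_def by (simp add: prime_elem_const_poly_iff prime_elem_linear_field_poly[of 1 0])

lemma coprime_XY: "coprime X Y"
proof (rule prime_elem_imp_coprime[OF prime_X])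
  show "\<not> X dvd Y"
  proof
    assume "X dvd Y"
    then obtain g where "Y = X * g" ..
    from arg_cong[OF this, of "\<lambda>f. value_at f (vector [0, 1, 0])"] show False by simp
  qed
qed

section \<open>A certificate for near freeness\<close>

text \<open>Here \<open>p\<^sub>4\<close> represents a generator of \<open>N(f)\<close> and \<open>l\<^sub>1, l\<^sub>2, l\<^sub>3\<close> generate its annihilator. The
  assumptions on \<open>lam\<close> say that \<open>S / (l\<^sub>1, l\<^sub>2, l\<^sub>3)\<close> is a quotient of \<open>\<complex>[lam] / (lam\<^sup>2)\<close>, so that \<open>N(f)\<close> has at
  most one dimension in each degree and is of finite length. By Euler's identity the assumption on the
  \<open>z\<close>-axis says that the curve does not pass through \<open>(0:0:1)\<close>.\<close>
locale nearly_free_certificate =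
  minors_3x4 b11 b12 b13 l1 b21 b22 b23 l2 b31 b32 b33 l3 p1 p2 p3 p4
  for b11 b12 b13 l1 b21 b22 b23 l2 b31 b32 b33 l3 p1 p2 p3 p4 :: poly3 +
  fixes f :: poly3 and m \<sigma> :: nat and \<kappa> :: complex and lam :: poly3 and c1 c2 c3 :: complex
  assumes f: "f \<in> forms (Suc m)"
    and f_dz_coprime: "coprime f (dz f)"
    and dz_axis: "restrict_z_axis (dz f) \<noteq> 0"
    and \<kappa>: "\<kappa> \<noteq> 0"
    and gradient: "p1 = const3 \<kappa> * dx f" "p2 = const3 \<kappa> * dy f" "p3 = const3 \<kappa> * dz f"
    and p4_form: "p4 \<in> forms \<sigma>"
    and l_origin: "value_at l1 0 = 0" "value_at l2 0 = 0" "value_at l3 0 = 0"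
    and variables: "X - const3 c1 * lam \<in> ideal_gen {l1, l2, l3}"
      "Y - const3 c2 * lam \<in> ideal_gen {l1, l2, l3}"
      "Z - const3 c3 * lam \<in> ideal_gen {l1, l2, l3}"
    and lam_square: "lam * lam \<in> ideal_gen {l1, l2, l3}"
begin

abbreviation "J \<equiv> jacobian_ideal f"
abbreviation "K \<equiv> ideal_gen {l1, l2, l3}"

lemma J_add: "a \<in> J \<Longrightarrow> b \<in> J \<Longrightarrow> a + b \<in> J" and J_mult: "a \<in> J \<Longrightarrow> r * a \<in> J"
  and J_diff: "a \<in> J \<Longrightarrow> b \<in> J \<Longrightarrow> a - b \<in> J"
  unfolding jacobian_ideal_def by (fact ideal_gen_add ideal_gen_mult ideal_gen_diff)+

lemma p_in_J: "p1 \<in> J" "p2 \<in> J" "p3 \<in> J"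
  unfolding gradient jacobian_ideal_def by (rule ideal_gen_mult, rule ideal_gen_base, simp)+

lemma J_eq: "J = ideal_gen {p1, p2, p3}"
proof
  show "ideal_gen {p1, p2, p3} \<subseteq> J"
    unfolding jacobian_ideal_def by (rule ideal_gen_subset) (use p_in_J in \<open>auto simp: jacobian_ideal_def\<close>)
  have "d = const3 (inverse \<kappa>) * (const3 \<kappa> * d)" for d
    using const3_unit[OF \<kappa>] by (simp flip: mult.assoc)
  then have "dx f = const3 (inverse \<kappa>) * p1" "dy f = const3 (inverse \<kappa>) * p2" "dz f = const3 (inverse \<kappa>) * p3"
    unfolding gradient by blast+
  then show "J \<subseteq> ideal_gen {p1, p2, p3}"
    unfolding jacobian_ideal_def
    by (intro ideal_gen_subset) (auto intro!: ideal_gen_mult[OF ideal_gen_base])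
qed

lemma f_in_J: "f \<in> J"
proof -
  have "const3 (inverse (of_nat (Suc m))) * (const3 (of_nat (Suc m)) * f) \<in> J"
    unfolding euler[OF f] jacobian_ideal_def
    by (intro ideal_gen_mult ideal_gen_add) (auto intro!: ideal_gen_base)
  then show ?thesis using const3_unit[of "of_nat (Suc m)"] by (simp flip: mult.assoc del: of_nat_Suc)
qed

lemma p3_axis: "restrict_z_axis p3 \<noteq> 0"
proof
  assume "restrict_z_axis p3 = 0"
  then have "restrict_z_axis (const3 (inverse \<kappa>) * p3) = 0"
    by (simp add: ring_hom_mult[OF ring_hom_restrict_z_axis])
  moreover have "const3 (inverse \<kappa>) * p3 = dz f"
    using const3_unit[OF \<kappa>] by (simp add: gradient flip: mult.assoc)
  ultimately show False using dz_axis by simp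
qed

sublocale hilbert_burch b11 b12 b13 l1 b21 b22 b23 l2 b31 b32 b33 l3 p1 p2 p3 p4 f
proof
  show "f \<in> ideal_gen {p1, p2, p3}" using f_in_J by (simp add: J_eq)
  have "const3 \<kappa> dvd 1" using const3_unit[OF \<kappa>] by (metis dvd_triv_right)
  then show "coprime f p3"
    using f_dz_coprime by (simp add: gradient is_unit_right_imp_coprime)
  show "p3 \<noteq> 0" using p3_axis by (auto simp: ring_hom_0[OF ring_hom_restrict_z_axis])
  show "f \<noteq> 0" using dz_axis by (auto simp: ring_hom_0[OF ring_hom_restrict_z_axis])
qed

text \<open>An expression of \<open>p\<^sub>4\<close> through the partial derivatives would be a syzygy with last entry \<open>- 1\<close>, but
  the last entry of any combination of the rows vanishes at the origin.\<close>
lemma p4_notin_J: "p4 \<notin> J"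
proof
  assume "p4 \<in> J"
  then obtain a1 a2 a3 where "p4 = a1 * p1 + a2 * p2 + a3 * p3" by (auto simp: J_eq in_ideal_gen3)
  then have "a1 * p1 + a2 * p2 + a3 * p3 + (- 1) * p4 = 0" by simp
  then obtain w1 w2 w3 where "- 1 = w1 * l1 + w2 * l2 + w3 * l3"
    using exact unfolding in_row_span_def by blast
  from arg_cong[OF this, of "\<lambda>g. value_at g 0"] show False by (simp add: l_origin)
qed

lemma K_times_p4: "k \<in> K \<Longrightarrow> k * p4 \<in> J"
proof -
  assume "k \<in> K"
  then obtain a1 a2 a3 where k: "k = a1 * l1 + a2 * l2 + a3 * l3" by (auto simp: in_ideal_gen3)
  have "l1 * p4 = (- b11) * p1 + (- b12) * p2 + (- b13) * p3" "l2 * p4 = (- b21) * p1 + (- b22) * p2 + (- b23) * p3"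
    "l3 * p4 = (- b31) * p1 + (- b32) * p2 + (- b33) * p3"
    using rows_are_syzygies[unfolded add_eq_0_iff] by simp_all
  then have l: "l1 * p4 \<in> J" "l2 * p4 \<in> J" "l3 * p4 \<in> J"
    unfolding J_eq in_ideal_gen3 by blast+
  have "a1 * (l1 * p4) + a2 * (l2 * p4) + a3 * (l3 * p4) \<in> J"
    by (rule J_add[OF J_add[OF J_mult[OF l(1)] J_mult[OF l(2)]] J_mult[OF l(3)]])
  then show ?thesis by (simp add: k algebra_simps)
qed

definition I :: "poly3 set" where
  "I = {g. \<exists>a1 a2 a3 a4. g = a1 * p1 + a2 * p2 + a3 * p3 + a4 * p4}"

text \<open>Writing \<open>x g\<close> and \<open>y g\<close> in terms of the generators gives a syzygy \<open>y a - x b\<close>, hence row coefficients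
  \<open>w\<close>. On the \<open>z\<close>-axis this syzygy vanishes while the rows stay independent, because \<open>p\<^sub>3\<close> does not vanish
  there; so \<open>w\<close> lies in \<open>(x, y)\<close>. Subtracting the corresponding rows makes \<open>a\<close> divisible by \<open>x\<close>.\<close>
lemma colon_I:
  assumes Xg: "X * g \<in> I" and Yg: "Y * g \<in> I"
  shows "g \<in> I"
proof -
  obtain a1 a2 a3 a4 where a: "X * g = a1 * p1 + a2 * p2 + a3 * p3 + a4 * p4"
    using Xg by (auto simp: I_def)
  obtain b1 b2 b3 b4 where b: "Y * g = b1 * p1 + b2 * p2 + b3 * p3 + b4 * p4"
    using Yg by (auto simp: I_def)
  have "(Y * a1 - X * b1) * p1 + (Y * a2 - X * b2) * p2 + (Y * a3 - X * b3) * p3 + (Y * a4 - X * b4) * p4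
      = Y * (X * g) - X * (Y * g)"
    unfolding a b by (simp add: algebra_simps)
  also have "\<dots> = 0" by simp
  finally obtain w1 w2 w3 where w:
    "Y * a1 - X * b1 = w1 * b11 + w2 * b21 + w3 * b31" "Y * a2 - X * b2 = w1 * b12 + w2 * b22 + w3 * b32"
    "Y * a3 - X * b3 = w1 * b13 + w2 * b23 + w3 * b33" "Y * a4 - X * b4 = w1 * l1 + w2 * l2 + w3 * l3"
    using exact unfolding in_row_span_def by blast
  interpret axis: minors_3x4 "restrict_z_axis b11" "restrict_z_axis b12" "restrict_z_axis b13" "restrict_z_axis l1"
    "restrict_z_axis b21" "restrict_z_axis b22" "restrict_z_axis b23" "restrict_z_axis l2"
    "restrict_z_axis b31" "restrict_z_axis b32" "restrict_z_axis b33" "restrict_z_axis l3"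
    "restrict_z_axis p1" "restrict_z_axis p2" "restrict_z_axis p3" "restrict_z_axis p4"
    by unfold_locales (simp_all only: p1 p2 p3 p4 ring_hom_simps[OF ring_hom_restrict_z_axis])
  have restr: "restrict_z_axis w1 * restrict_z_axis r1 + restrict_z_axis w2 * restrict_z_axis r2 +
      restrict_z_axis w3 * restrict_z_axis r3 = 0" if "Y * s - X * t = w1 * r1 + w2 * r2 + w3 * r3" for s t r1 r2 r3
    using arg_cong[OF that, of restrict_z_axis]
    by (simp add: ring_hom_simps[OF ring_hom_restrict_z_axis] restrict_z_axis_XYZ)
  have "restrict_z_axis w1 = 0" "restrict_z_axis w2 = 0" "restrict_z_axis w3 = 0"
    using axis.minor_times_dependency[OF restr[OF w(1)] restr[OF w(2)] restr[OF w(4)]] p3_axis by auto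
  then obtain u1 v1 u2 v2 u3 v3 where uv:
    "w1 = X * u1 + Y * v1" "w2 = X * u2 + Y * v2" "w3 = X * u3 + Y * v3"
    by (meson restrict_z_axis_eq_0)
  have X_dvd: "X dvd s - (v1 * r1 + v2 * r2 + v3 * r3)" if "Y * s - X * t = w1 * r1 + w2 * r2 + w3 * r3" for s t r1 r2 r3
  proof -
    have "Y * (s - (v1 * r1 + v2 * r2 + v3 * r3)) = X * (t + (u1 * r1 + u2 * r2 + u3 * r3))"
      using that unfolding uv by (simp add: algebra_simps)
    then have "X dvd Y * (s - (v1 * r1 + v2 * r2 + v3 * r3))" by (metis dvd_triv_left)
    then show ?thesis using coprime_dvd_mult_right_iff[OF coprime_XY] by blast
  qed
  obtain e1 e2 e3 e4 where e:
    "a1 - (v1 * b11 + v2 * b21 + v3 * b31) = X * e1" "a2 - (v1 * b12 + v2 * b22 + v3 * b32) = X * e2"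
    "a3 - (v1 * b13 + v2 * b23 + v3 * b33) = X * e3" "a4 - (v1 * l1 + v2 * l2 + v3 * l3) = X * e4"
    using X_dvd[OF w(1)] X_dvd[OF w(2)] X_dvd[OF w(3)] X_dvd[OF w(4)] by (meson dvdE)
  have "X * (e1 * p1 + e2 * p2 + e3 * p3 + e4 * p4) =
      (X * e1) * p1 + (X * e2) * p2 + (X * e3) * p3 + (X * e4) * p4" by (simp add: algebra_simps)
  also have "\<dots> = a1 * p1 + a2 * p2 + a3 * p3 + a4 * p4
     - v1 * (b11 * p1 + b12 * p2 + b13 * p3 + l1 * p4) - v2 * (b21 * p1 + b22 * p2 + b23 * p3 + l2 * p4)
     - v3 * (b31 * p1 + b32 * p2 + b33 * p3 + l3 * p4)"
    unfolding e[symmetric] by (simp add: algebra_simps)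
  also have "\<dots> = X * g" unfolding rows_are_syzygies a[symmetric] by simp
  finally have "X * (e1 * p1 + e2 * p2 + e3 * p3 + e4 * p4) = X * g" .
  then have "g = e1 * p1 + e2 * p2 + e3 * p3 + e4 * p4"
    using prime_X by (auto simp: prime_elem_def)
  then show ?thesis by (auto simp: I_def)
qed

lemma in_I_of_power:
  assumes "\<And>h. h \<in> ideal_power irrelevant_ideal n \<Longrightarrow> h * g \<in> I"
  shows "g \<in> I"
  using assms
proof (induction n)
  case 0
  have "1 * g \<in> I" by (rule 0) (simp only: ideal_power.simps UNIV_I)
  then show ?case by (simp only: mult_1_left)
next
  case (Suc n)
  show ?case
  proof (rule Suc.IH)
    fix h assume h: "h \<in> ideal_power irrelevant_ideal n"
    have "v * (h * g) \<in> I" if v: "v \<in> {X, Y, Z}" for v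
    proof -
      have "v \<in> irrelevant_ideal" unfolding irrelevant_ideal_eq by (rule ideal_gen_base[OF v])
      then have "v * h \<in> {a * b | a b. a \<in> irrelevant_ideal \<and> b \<in> ideal_power irrelevant_ideal n}"
        using h by (intro CollectI exI conjI) (rule refl)
      then have "v * h \<in> ideal_power irrelevant_ideal (Suc n)"
        unfolding ideal_power.simps by (rule ideal_gen_base)
      from Suc.prems[OF this] show ?thesis by (simp only: mult.assoc)
    qed
    from this[OF insertI1] this[OF insertI2[OF insertI1]] show "h * g \<in> I" by (rule colon_I)
  qed
qed

lemma saturated_subset_I: "saturated_jacobian_ideal f \<subseteq> I"
proof
  have J_I: "J \<subseteq> I"
  proof
    fix g assume "g \<in> J"
    then obtain a1 a2 a3 where "g = a1 * p1 + a2 * p2 + a3 * p3 + 0 * p4" by (auto simp: J_eq in_ideal_gen3)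
    then show "g \<in> I" unfolding I_def by blast
  qed
  fix g assume "g \<in> saturated_jacobian_ideal f"
  then obtain n where n: "\<forall>h \<in> ideal_power irrelevant_ideal n. h * g \<in> J"
    unfolding saturated_jacobian_ideal_def saturation_def by blast
  show "g \<in> I" by (rule in_I_of_power[of n], rule subsetD[OF J_I], rule bspec[OF n])
qed

text \<open>Every form of degree \<open>n\<close> lies in this set. As these sets are multiplicative, it suffices that the
  variables lie in the one for \<open>n = 1\<close>.\<close>
definition scalar_mod_K :: "nat \<Rightarrow> poly3 set" where
  "scalar_mod_K n = {h. \<exists>c. h - const3 c * lam ^ n \<in> K}"

lemma scalar_mod_K_mult:
  assumes "g \<in> scalar_mod_K a" "h \<in> scalar_mod_K b"
  shows "g * h \<in> scalar_mod_K (a + b)"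
proof -
  obtain c d where c: "g - const3 c * lam ^ a \<in> K" and d: "h - const3 d * lam ^ b \<in> K"
    using assms by (auto simp: scalar_mod_K_def)
  have "h * (g - const3 c * lam ^ a) + (const3 c * lam ^ a) * (h - const3 d * lam ^ b) \<in> K"
    by (intro ideal_gen_add ideal_gen_mult c d)
  also have "h * (g - const3 c * lam ^ a) + (const3 c * lam ^ a) * (h - const3 d * lam ^ b)
      = g * h - const3 (c * d) * lam ^ (a + b)"
    by (simp add: ring_hom_mult[OF ring_hom_const3] power_add algebra_simps)
  finally show ?thesis by (auto simp: scalar_mod_K_def)
qed

lemma scalar_mod_K_const: "const3 c \<in> scalar_mod_K 0"
  by (auto simp: scalar_mod_K_def ideal_gen_0 intro!: exI[of _ c])

lemma scalar_mod_K_power: "g \<in> scalar_mod_K 1 \<Longrightarrow> g ^ n \<in> scalar_mod_K n"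
proof (induction n)
  case 0
  show ?case using scalar_mod_K_const[of 1] by (simp add: ring_hom_1[OF ring_hom_const3])
next
  case (Suc n)
  then show ?case using scalar_mod_K_mult[of g 1 "g ^ n" n] by simp
qed

lemma scalar_mod_K_sum:
  assumes "\<And>i. i \<in> A \<Longrightarrow> h i \<in> scalar_mod_K n"
  shows "sum h A \<in> scalar_mod_K n"
proof -
  have "\<forall>i\<in>A. \<exists>c. h i - const3 c * lam ^ n \<in> K" using assms by (simp add: scalar_mod_K_def)
  then obtain c where c: "\<forall>i\<in>A. h i - const3 (c i) * lam ^ n \<in> K" by (auto dest: bchoice)
  have "(\<Sum>i\<in>A. h i - const3 (c i) * lam ^ n) \<in> K" by (rule ideal_gen_sum) (rule bspec[OF c])
  also have "(\<Sum>i\<in>A. h i - const3 (c i) * lam ^ n) = sum h A - const3 (sum c A) * lam ^ n"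
    by (simp add: sum_subtractf sum_distrib_right ring_hom_sum[OF ring_hom_const3])
  finally show ?thesis by (auto simp: scalar_mod_K_def)
qed

lemma hcomp_scalar_mod_K: "hcomp n h \<in> scalar_mod_K n"
proof -
  have v: "X \<in> scalar_mod_K 1" "Y \<in> scalar_mod_K 1" "Z \<in> scalar_mod_K 1"
    using variables by (auto simp: scalar_mod_K_def)
  have "const3 c * X ^ i * Y ^ j * Z ^ k \<in> scalar_mod_K (0 + i + j + k)" for c i j k
    by (intro scalar_mod_K_mult scalar_mod_K_const scalar_mod_K_power v)
  moreover have "0 \<in> scalar_mod_K n"
    by (auto simp: scalar_mod_K_def ideal_gen_0 ring_hom_0[OF ring_hom_const3] intro!: exI[of _ 0])
  ultimately show ?thesis unfolding hcomp_expansion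
    by (intro scalar_mod_K_sum) auto
qed

lemma p4_in_saturation: "p4 \<in> saturated_jacobian_ideal f"
proof -
  let ?m = "ideal_gen {X, Y, Z}"
  have m1: "\<exists>r. h - r * lam \<in> K" if "h \<in> ?m" for h
  proof -
    obtain x y z where h: "h = x * X + y * Y + z * Z" using \<open>h \<in> ?m\<close> by (auto simp: in_ideal_gen3)
    have "x * (X - const3 c1 * lam) + y * (Y - const3 c2 * lam) + z * (Z - const3 c3 * lam) \<in> K"
      by (intro ideal_gen_add ideal_gen_mult variables)
    also have "x * (X - const3 c1 * lam) + y * (Y - const3 c2 * lam) + z * (Z - const3 c3 * lam)
        = h - (x * const3 c1 + y * const3 c2 + z * const3 c3) * lam"
      by (simp add: h algebra_simps)
    finally show ?thesis by (rule exI)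
  qed
  have m2: "a * b \<in> K" if a: "a \<in> ?m" and b: "b \<in> ?m" for a b
  proof -
    obtain r s where r: "a - r * lam \<in> K" and s: "b - s * lam \<in> K" using m1[OF a] m1[OF b] by blast
    have "b * (a - r * lam) + (r * lam) * (b - s * lam) + (r * s) * (lam * lam) \<in> K"
      by (intro ideal_gen_add ideal_gen_mult r s lam_square)
    also have "b * (a - r * lam) + (r * lam) * (b - s * lam) + (r * s) * (lam * lam) = a * b"
      by (simp add: algebra_simps)
    finally show ?thesis .
  qed
  have right: "a * b \<in> ?m" if "a \<in> ?m" for a b
    using ideal_gen_mult[OF that, of b] by (simp only: mult.commute)
  have m_power_1: "ideal_power ?m 1 \<subseteq> ?m"
    unfolding One_nat_def ideal_power.simps by (rule ideal_gen_subset) (auto intro: right)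
  have "a * b \<in> K" if "a \<in> ?m" "b \<in> ideal_power ?m 1" for a b
    using m2 that m_power_1 by blast
  then have "ideal_power ?m (Suc 1) \<subseteq> K"
    unfolding ideal_power.simps(2)[of _ 1] by (intro ideal_gen_subset) auto
  then have "\<forall>h \<in> ideal_power irrelevant_ideal (Suc 1). h * p4 \<in> J"
    unfolding irrelevant_ideal_eq using K_times_p4 by (meson subsetD)
  then show ?thesis
    unfolding saturated_jacobian_ideal_def saturation_def by (intro CollectI exI)
qed

text \<open>The saturation lies in \<open>I = J + (p\<^sub>4)\<close>, and the homogeneous multiples of \<open>p\<^sub>4\<close> in degree \<open>j\<close> are scalar
  multiples of a single element modulo \<open>J\<close>.\<close>
lemma saturation_degree:
  assumes v: "v \<in> saturated_jacobian_ideal f" "v \<in> forms j"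
  shows "\<exists>c. v - const3 c * (lam ^ (j - \<sigma>) * p4) \<in> J"
proof -
  obtain a1 a2 a3 a4 where a: "v = a1 * p1 + a2 * p2 + a3 * p3 + a4 * p4"
    using v saturated_subset_I by (auto simp: I_def)
  have p: "p1 \<in> forms m" "p2 \<in> forms m" "p3 \<in> forms m"
    unfolding gradient by (intro forms_scale forms_partials f)+
  have hJ: "hcomp j (r * p) \<in> J" if "p \<in> J" "p \<in> forms m" for r p
    using J_mult[OF that(1)] J_diff[OF that(1) that(1)] by (simp add: hcomp_mult_form[OF that(2)])
  have "v = hcomp j (a1 * p1) + hcomp j (a2 * p2) + hcomp j (a3 * p3) + hcomp j (a4 * p4)"
    using hcomp_form[OF v(2)] a by (simp add: hcomp_sum)
  moreover have "hcomp j (a1 * p1) + hcomp j (a2 * p2) + hcomp j (a3 * p3) \<in> J" (is "?q \<in> J")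
    by (intro J_add hJ p_in_J p)
  ultimately have q: "v - hcomp j (a4 * p4) \<in> J" by simp
  show ?thesis
  proof (cases "j < \<sigma>")
    case True
    then show ?thesis using q
      by (intro exI[of _ 0]) (simp add: hcomp_mult_form[OF p4_form] ring_hom_0[OF ring_hom_const3])
  next
    case False
    obtain c where "hcomp (j - \<sigma>) a4 - const3 c * lam ^ (j - \<sigma>) \<in> K"
      using hcomp_scalar_mod_K by (auto simp: scalar_mod_K_def)
    from K_times_p4[OF this] q have
      "(v - hcomp j (a4 * p4)) + (hcomp (j - \<sigma>) a4 - const3 c * lam ^ (j - \<sigma>)) * p4 \<in> J"
      by (intro J_add)
    also have "(v - hcomp j (a4 * p4)) + (hcomp (j - \<sigma>) a4 - const3 c * lam ^ (j - \<sigma>)) * p4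
        = v - const3 c * (lam ^ (j - \<sigma>) * p4)"
      using False by (simp add: hcomp_mult_form[OF p4_form] algebra_simps)
    finally show ?thesis by (rule exI)
  qed
qed

theorem certified: "nearly_free f"
  unfolding nearly_free_def
proof (intro conjI allI)
  show "saturated_jacobian_ideal f \<noteq> J" using p4_in_saturation p4_notin_J by blast
  fix j
  let ?V = "saturated_jacobian_ideal f \<inter> forms j" and ?W = "J \<inter> forms j"
  show "\<exists>n\<le>1. has_quotient_dim (\<lambda>c g. const3 c * g) ?V ?W n"
  proof (cases "?V \<subseteq> ?W")
    case True
    then have "has_quotient_dim (\<lambda>c g. const3 c * g) ?V ?W 0"
      unfolding has_quotient_dim_def by (intro exI[of _ "{}"]) auto
    then show ?thesis by blast
  next
    case False
    then obtain v0 where v0: "v0 \<in> saturated_jacobian_ideal f" "v0 \<in> forms j" "v0 \<notin> J" by blast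
    let ?u = "lam ^ (j - \<sigma>) * p4"
    obtain c0 where c0: "v0 - const3 c0 * ?u \<in> J" using saturation_degree v0 by blast
    have "c0 \<noteq> 0" using c0 v0(3) by (auto simp: ring_hom_0[OF ring_hom_const3])
    have span: "\<exists>c. v - (\<Sum>b\<in>{v0}. const3 (c b) * b) \<in> ?W" if v: "v \<in> ?V" for v
    proof -
      obtain c where c: "v - const3 c * ?u \<in> J" using saturation_degree v by blast
      have "(v - const3 c * ?u) - const3 (c / c0) * (v0 - const3 c0 * ?u) \<in> J"
        by (rule J_diff[OF c J_mult[OF c0]])
      moreover have "const3 (c / c0) * (const3 c0 * ?u) = const3 c * ?u"
        using \<open>c0 \<noteq> 0\<close> by (simp flip: mult.assoc ring_hom_mult[OF ring_hom_const3])
      ultimately have "v - const3 (c / c0) * v0 \<in> J" by (simp add: right_diff_distrib)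
      moreover have "v - const3 (c / c0) * v0 \<in> forms j"
        using v v0 by (intro forms_diff forms_scale) auto
      ultimately show ?thesis by (intro exI[of _ "\<lambda>_. c / c0"]) simp
    qed
    have indep: "c = 0" if "const3 c * v0 \<in> J" for c
    proof (rule ccontr)
      assume "c \<noteq> 0"
      have "const3 (inverse c) * (const3 c * v0) \<in> J" by (rule J_mult[OF that])
      then show False using v0(3) const3_unit[OF \<open>c \<noteq> 0\<close>] by (simp flip: mult.assoc)
    qed
    have "has_quotient_dim (\<lambda>c g. const3 c * g) ?V ?W 1"
      unfolding has_quotient_dim_def
    proof (intro exI[of _ "{v0}"] conjI allI impI ballI)
      show "{v0} \<subseteq> ?V" using v0 by blast
      show "c b = 0" if "(\<Sum>b\<in>{v0}. const3 (c b) * b) \<in> ?W" "b \<in> {v0}" for c b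
        using that indep[of "c v0"] by simp
      show "\<exists>c. v - (\<Sum>b\<in>{v0}. const3 (c b) * b) \<in> ?W" if "v \<in> ?V" for v by (rule span[OF that])
    qed simp_all
    then show ?thesis by blast
  qed
qed

end

section \<open>The arrangements\<close>

lemma forms_arith:
  "f \<in> forms 1 \<Longrightarrow> g \<in> forms 1 \<Longrightarrow> f * g \<in> forms 2"
  "h \<in> forms 2 \<Longrightarrow> f \<in> forms 1 \<Longrightarrow> h * f \<in> forms 3"
  "f \<in> forms n \<Longrightarrow> numeral k * f \<in> forms n"
  "1 \<in> forms 0"
  using forms_numeral[of Num.One] by (auto intro: forms_mult[OF forms_numeral] forms_mult)

lemmas forms_intros = forms_arith forms_add forms_diff forms_minus forms_zero forms_XYZ

definition lines :: "poly3 list" where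
  "lines = [Z, X - Z, Y - Z, X + Z, Y + Z]"

definition conic :: poly3 where
  "conic = X * X + Y * Y - Z * Z"

definition arrangement :: "nat \<Rightarrow> poly3" where
  "arrangement d = (\<Prod>i<d. lines ! i) * conic"

lemma less_5: "i < 5 \<longleftrightarrow> i = 0 \<or> i = 1 \<or> i = 2 \<or> i = 3 \<or> i = (4::nat)"
  by auto

lemma lines_nth [simp]: "lines ! 0 = Z" "lines ! 1 = X - Z" "lines ! Suc 0 = X - Z" "lines ! 2 = Y - Z"
  "lines ! 3 = X + Z" "lines ! 4 = Y + Z"
  by (simp_all add: lines_def)

lemma lines_form: "i < 5 \<Longrightarrow> lines ! i \<in> forms 1"
  by (auto simp: less_5 intro!: forms_intros forms_XYZ[unfolded One_nat_def])

lemma conic_form: "conic \<in> forms 2"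
  unfolding conic_def by (intro forms_intros)

lemma arrangement_form:
  assumes "d \<le> 5"
  shows "arrangement d \<in> forms (d + 2)"
proof -
  have "(\<Prod>i<d. lines ! i) \<in> forms d"
    using assms
  proof (induction d)
    case 0
    show ?case using forms_arith(4) by simp
  next
    case (Suc d)
    then have "(\<Prod>i<d. lines ! i) * lines ! d \<in> forms (Suc d)"
      by (intro forms_mult[OF _ lines_form]) simp_all
    then show ?case by simp
  qed
  then show ?thesis unfolding arrangement_def by (rule forms_mult[OF _ conic_form refl])
qed

text \<open>The \<open>i\<close>-th point lies on the \<open>i\<close>-th line, off the other lines and off the conic.\<close>
definition line_point :: "nat \<Rightarrow> complex^3" where
  "line_point i = [vector [2, 3, 0], vector [1, 2, 1], vector [2, 1, 1], vector [- 1, 2, 1], vector [2, - 1, 1]] ! i"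

lemma value_at_line_point:
  assumes "i < 5" "j < 5"
  shows "value_at (lines ! i) (line_point j) = 0 \<longleftrightarrow> i = j"
  using assms by (auto simp: less_5 line_point_def)

lemma value_at_conic_line_point: "i < 5 \<Longrightarrow> value_at conic (line_point i) \<noteq> 0"
  by (auto simp: less_5 line_point_def conic_def)

text \<open>Divisibility by a linear polynomial with invertible leading coefficient means vanishing at its root.\<close>
lemma prime_elem_linear_factor:
  fixes a b :: "'a::{idom_divide, algebraic_semidom}"
  assumes "is_unit b"
  shows "prime_elem [:a, b:]"
  unfolding prime_elem_def
proof (intro conjI allI impI)
  obtain c where c: "1 = b * c" using assms by (elim dvdE)
  have b: "b \<noteq> 0" using c by auto
  have root: "[:a, b:] dvd p \<longleftrightarrow> poly p (- a * c) = 0" for p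
  proof -
    have "[:a, b:] = [:- (- a * c), 1:] * [:b:]" using c by (simp add: mult.commute mult.left_commute flip: mult.assoc)
    moreover have "is_unit [:b:]" using assms by (simp add: is_unit_const_poly_iff)
    ultimately show ?thesis by (simp only: mult_unit_dvd_iff poly_eq_0_iff_dvd)
  qed
  show "[:a, b:] \<noteq> 0" using b by simp
  show "\<not> is_unit [:a, b:]" by (simp add: root)
  show "[:a, b:] dvd p \<or> [:a, b:] dvd q" if "[:a, b:] dvd p * q" for p q
    using that by (simp add: root)
qed

lemma prime_elem_line:
  assumes "i < 5"
  shows "prime_elem (lines ! i)"
proof -
  have "lines ! i \<in> {[:0, 1:], [:[:[:0, 1:]:], - 1:], [:[:0, 1:], - 1:], [:[:[:0, 1:]:], 1:], [:[:0, 1:], 1:]}"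
    using assms by (auto simp: less_5 X_def Y_def Z_def)
  then show ?thesis by (auto intro!: prime_elem_linear_factor)
qed

lemma linear_poly_eq:
  assumes "degree p \<le> 1"
  shows "p = [:coeff p 0, coeff p 1:]"
  using assms by (intro poly_eqI) (auto simp: coeff_pCons coeff_eq_0 split: nat.splits)

lemma not_square: "(s :: complex poly poly)\<^sup>2 \<noteq> [:[:0, 1:]\<^sup>2, 0, 1:]"
proof
  assume s: "s\<^sup>2 = [:[:0, 1:]\<^sup>2, 0, 1:]"
  then have "s \<noteq> 0" by auto
  then have "degree s + degree s = degree (s\<^sup>2)" by (simp add: power2_eq_square degree_mult_eq)
  also have "\<dots> = 2" unfolding s by simp
  finally have deg: "degree s = 1" by simp
  obtain a b where ab: "s = [:a, b:]" using linear_poly_eq[of s] deg by auto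
  then have "b \<noteq> 0" using deg by auto
  note ab
  then have aa: "a * a = [:0, 1:]\<^sup>2" and "a * b + b * a = 0"
    using s by (simp_all add: power2_eq_square)
  then have "2 * (a * b) = 0" by (simp add: mult_2 mult.commute)
  then have "a = 0" using \<open>b \<noteq> 0\<close> by simp
  then show False using aa by simp
qed

text \<open>A factorisation of \<open>x\<^sup>2 + y\<^sup>2 - z\<^sup>2\<close> into two factors of degree one in \<open>z\<close> would make \<open>x\<^sup>2 + y\<^sup>2\<close> a square in
  \<open>\<complex>[x][y]\<close>.\<close>
lemma irreducible_conic: "irreducible conic"
proof (rule irreducibleI)
  have conic: "conic = [:[:[:0, 1:]\<^sup>2, 0, 1:], 0, - 1:]"
    by (simp add: conic_def X_def Y_def Z_def power2_eq_square)
  show "conic \<noteq> 0" "\<not> is_unit conic"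
    by (auto simp: conic is_unit_poly_iff)
  have unit: "is_unit p" if pq: "conic = p * q" and "degree p = 0" for p q
  proof -
    obtain a where a: "p = [:a:]" using \<open>degree p = 0\<close> by (rule degree_eq_zeroE)
    have "coeff conic 2 = a * coeff q 2" by (simp add: pq a)
    then have "a dvd - 1" by (simp add: conic numeral_2_eq_2)
    then show ?thesis by (simp add: a is_unit_const_poly_iff)
  qed
  fix p q assume pq: "conic = p * q"
  have nz: "p \<noteq> 0" "q \<noteq> 0" using pq \<open>conic \<noteq> 0\<close> by auto
  have "degree p + degree q = 2"
    using degree_mult_eq[OF nz] by (simp flip: pq) (simp add: conic)
  then consider "degree p = 0" | "degree q = 0" | "degree p = 1" "degree q = 1" by force
  then show "is_unit p \<or> is_unit q"
  proof cases
    case 1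
    then show ?thesis using unit[OF pq] by blast
  next
    case 2
    then show ?thesis using unit[of q p] pq by (simp add: mult.commute)
  next
    case 3
    then obtain a b c d where p: "p = [:a, b:]" and q: "q = [:c, d:]"
      using linear_poly_eq[of p] linear_poly_eq[of q] by (metis order_refl)
    have ac: "a * c = [:[:0, 1:]\<^sup>2, 0, 1:]" and ad: "a * d + b * c = 0" and bd: "b * d = - 1"
      using pq unfolding conic p q by (simp_all add: algebra_simps)
    have "(a * d)\<^sup>2 = (a * d) * (a * d + b * c) - (a * d) * (b * c)" by (simp add: power2_eq_square algebra_simps)
    also have "\<dots> = - (a * d) * (b * c)" unfolding ad by simp
    also have "\<dots> = - (a * c) * (b * d)" by (simp add: algebra_simps)
    also have "\<dots> = [:[:0, 1:]\<^sup>2, 0, 1:]" using ac bd by simp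
    finally show ?thesis using not_square by blast
  qed
qed

text \<open>At a point \<open>p\<close> of the component \<open>q\<close> the derivative of \<open>q u\<close> is the derivative of \<open>q\<close> times \<open>u\<close>.\<close>
lemma not_dvd_dz:
  assumes f: "f = q * u" and q: "value_at q p = 0" "value_at (dz q) p \<noteq> 0" and u: "value_at u p \<noteq> 0"
  shows "\<not> q dvd dz f"
proof
  assume "q dvd dz f"
  then obtain r where "dz f = q * r" ..
  from arg_cong[OF this, of "\<lambda>g. value_at g p"] show False using q u by (simp add: f)
qed

lemma arrangement_coprime_dz:
  assumes d: "d \<le> 5"
  shows "coprime (arrangement d) (dz (arrangement d))"
proof -
  let ?f = "arrangement d"
  have line: "coprime (lines ! i) (dz ?f)" if i: "i < d" for i
  proof (rule prime_elem_imp_coprime)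
    show "prime_elem (lines ! i)" using i d by (intro prime_elem_line) simp
    show "\<not> lines ! i dvd dz ?f"
    proof (rule not_dvd_dz)
      show "?f = lines ! i * ((\<Prod>j\<in>{..<d} - {i}. lines ! j) * conic)"
        unfolding arrangement_def using i by (subst prod.remove[of _ i]) (auto simp: mult.assoc)
      show "value_at (lines ! i) (line_point i) = 0" using i d by (simp add: value_at_line_point)
      show "value_at (dz (lines ! i)) (line_point i) \<noteq> 0"
        using i d less_5[of i] by auto
      show "value_at ((\<Prod>j\<in>{..<d} - {i}. lines ! j) * conic) (line_point i) \<noteq> 0"
        using i d value_at_conic_line_point[of i] by (auto simp: value_at_line_point)
    qed
  qed
  have conic: "coprime conic (dz ?f)"
  proof (rule prime_elem_imp_coprime)
    show "prime_elem conic" using irreducible_conic by (rule irreducible_imp_prime_elem_gcd)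
    let ?p = "vector [3, 4, 5] :: complex^3"
    have "value_at (lines ! i) ?p \<noteq> 0" if "i < d" for i
      using that d less_5[of i] by auto
    then show "\<not> conic dvd dz ?f"
      by (intro not_dvd_dz[of _ _ "\<Prod>i<d. lines ! i" ?p]) (auto simp: arrangement_def conic_def mult.commute)
  qed
  show ?thesis
    unfolding arrangement_def[of d] using conic line
    by (auto intro!: prod_coprime_left simp: arrangement_def coprime_mult_left_iff)
qed

text \<open>By Euler's identity a form that does not vanish at \<open>(0:0:1)\<close> has a nonzero \<open>z\<close>-derivative there.\<close>
lemma dz_on_z_axis:
  assumes f: "f \<in> forms (Suc m)" and p: "value_at f (vector [0, 0, 1]) \<noteq> 0"
  shows "restrict_z_axis (dz f) \<noteq> 0"
proof
  assume "restrict_z_axis (dz f) = 0"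
  then obtain u v where "dz f = X * u + Y * v" using restrict_z_axis_eq_0 by blast
  then have "value_at (const3 (of_nat (Suc m)) * f) (vector [0, 0, 1]) = 0"
    unfolding euler[OF f] by simp
  then show False using p by (simp del: of_nat_Suc)
qed

lemma arrangement_dz_axis:
  assumes "d \<le> 5"
  shows "restrict_z_axis (dz (arrangement d)) \<noteq> 0"
proof (rule dz_on_z_axis)
  show "arrangement d \<in> forms (Suc (Suc d))" using arrangement_form[OF assms] by simp
  have "value_at (lines ! i) (vector [0, 0, 1]) \<noteq> 0" if "i < d" for i
    using that assms less_5[of i] by auto
  then show "value_at (arrangement d) (vector [0, 0, 1]) \<noteq> 0"
    by (auto simp: arrangement_def conic_def)
qed

section \<open>The five certificates\<close>

lemma nearly_free_arrangementI:
  assumes d: "d \<le> 5" and \<kappa>: "\<kappa> \<noteq> 0"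
    and gradient:
      "of_nat \<kappa> * dx (arrangement d) = al * (b_y * cz - bz * cy) + bl * (cy * az - cz * ay) + cl * (ay * bz - az * b_y)"
      "of_nat \<kappa> * dy (arrangement d) = al * (bz * cx - bx * cz) + bl * (cz * ax - cx * az) + cl * (az * bx - ax * bz)"
      "of_nat \<kappa> * dz (arrangement d) = al * (bx * cy - b_y * cx) + bl * (cx * ay - cy * ax) + cl * (ax * b_y - ay * bx)"
    and forms: "ax \<in> forms na" "ay \<in> forms na" "az \<in> forms na" "bx \<in> forms nb" "b_y \<in> forms nb" "bz \<in> forms nb"
      "cx \<in> forms nc" "cy \<in> forms nc" "cz \<in> forms nc"
    and origin: "value_at al 0 = 0" "value_at bl 0 = 0" "value_at cl 0 = 0"
    and variables: "X - const3 \<alpha> * lam \<in> ideal_gen {al, bl, cl}" "Y - const3 \<beta> * lam \<in> ideal_gen {al, bl, cl}"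
      "Z - const3 \<gamma> * lam \<in> ideal_gen {al, bl, cl}"
    and lam_square: "lam * lam \<in> ideal_gen {al, bl, cl}"
  shows "nearly_free (arrangement d)"
proof -
  let ?p4 = "- (ax * (b_y * cz - bz * cy) + bx * (cy * az - cz * ay) + cx * (ay * bz - az * b_y))"
  have minor: "a * (b * c - b' * c') \<in> forms n"
    if "a \<in> forms i" "b \<in> forms j" "c \<in> forms k" "b' \<in> forms j" "c' \<in> forms k" "n = i + (j + k)" for a b c b' c' i j k n
    using that by (intro forms_mult[of a i _ "j + k"] forms_diff forms_mult[of _ j _ k]) simp_all
  have "?p4 \<in> forms (na + nb + nc)"
    by (intro forms_minus forms_add; (rule minor, (rule forms)+, simp))
  then interpret nearly_free_certificate ax ay az al bx b_y bz bl cx cy cz cl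
    "of_nat \<kappa> * dx (arrangement d)" "of_nat \<kappa> * dy (arrangement d)" "of_nat \<kappa> * dz (arrangement d)" ?p4
    "arrangement d" "Suc d" "na + nb + nc" "of_nat \<kappa>" lam \<alpha> \<beta> \<gamma>
    using arrangement_form[OF d] d
    by unfold_locales (simp_all add: arrangement_coprime_dz arrangement_dz_axis gradient origin variables lam_square \<kappa> flip: const3_of_nat)
  show ?thesis by (rule certified)
qed

lemma ideal_gen_numeral_cancel:
  assumes "numeral k * g \<in> ideal_gen A"
  shows "g \<in> ideal_gen (A :: poly3 set)"
proof -
  have "const3 (inverse (numeral k)) * (numeral k * g) \<in> ideal_gen A" by (rule ideal_gen_mult[OF assms])
  then show ?thesis
    using const3_unit[of "numeral k"] by (simp add: ring_hom_numeral[OF ring_hom_const3] flip: mult.assoc)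
qed

lemma arrangement_eq:
  "arrangement 1 = Z * conic"
  "arrangement 2 = Z * (X - Z) * conic"
  "arrangement 3 = Z * (X - Z) * (Y - Z) * conic"
  "arrangement 4 = Z * (X - Z) * (Y - Z) * (X + Z) * conic"
  "arrangement 5 = Z * (X - Z) * (Y - Z) * (X + Z) * (Y + Z) * conic"
  by (simp_all add: arrangement_def numeral_eq_Suc lines_def)

text \<open>The rows below come from solving linear equations: \<open>l\<^sub>i\<close> runs through generators of the annihilator of a
  generator \<open>g\<close> of \<open>N(f)\<close>, and the remaining entries of a row express \<open>l\<^sub>i g\<close> in terms of the partial
  derivatives. Each row is rescaled to integer coefficients, which produces the factor \<open>\<kappa>\<close>.\<close>
lemma nearly_free_arrangement_1: "nearly_free (arrangement 1)"
proof (rule nearly_free_arrangementI[where \<kappa> = 2 and na = 0 and nb = 0 and nc = 1 and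
    lam = Z and \<alpha> = 0 and \<beta> = 0 and \<gamma> = 1 and
    ax = "0" and ay = "- 1" and az = "0" and al = "2 * Y" and
    bx = "- 1" and b_y = "0" and bz = "0" and bl = "2 * X" and
    cx = "- X" and cy = "- Y" and cz = "2 * Z" and cl = "6 * (Z * Z)"])
  let ?K = "ideal_gen {2 * Y, 2 * X, 6 * (Z * Z)}"
  have K: "2 * Y \<in> ?K" "2 * X \<in> ?K" "6 * (Z * Z) \<in> ?K"
    by (rule ideal_gen_base, simp)+
  from K[THEN ideal_gen_numeral_cancel]
  show "X - const3 0 * Z \<in> ?K" "Y - const3 0 * Z \<in> ?K" "Z - const3 1 * Z \<in> ?K" "Z * Z \<in> ?K"
    by (simp_all add: ring_hom_0[OF ring_hom_const3] ring_hom_1[OF ring_hom_const3] ideal_gen_0 ideal_gen_mult)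
qed (intro forms_intros | simp add: arrangement_eq arrangement_eq(1)[unfolded One_nat_def] conic_def algebra_simps)+

lemma nearly_free_arrangement_2: "nearly_free (arrangement 2)"
proof (rule nearly_free_arrangementI[where \<kappa> = 12 and na = 1 and nb = 1 and nc = 1 and
    lam = Z and \<alpha> = 0 and \<beta> = 0 and \<gamma> = 1 and
    ax = "5 * X + 4 * Z" and ay = "Y" and az = "4 * X + Z" and al = "12 * X" and
    bx = "2 * Y" and b_y = "Z - X" and bz = "Y" and bl = "3 * Y" and
    cx = "X + 4 * Z" and cy = "Y" and cz = "Z" and cl = "12 * Z"])
  let ?K = "ideal_gen {12 * X, 3 * Y, 12 * Z}"
  have K: "12 * X \<in> ?K" "3 * Y \<in> ?K" "12 * Z \<in> ?K"
    by (rule ideal_gen_base, simp)+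
  from K[THEN ideal_gen_numeral_cancel]
  show "X - const3 0 * Z \<in> ?K" "Y - const3 0 * Z \<in> ?K" "Z - const3 1 * Z \<in> ?K" "Z * Z \<in> ?K"
    by (simp_all add: ring_hom_0[OF ring_hom_const3] ring_hom_1[OF ring_hom_const3] ideal_gen_0 ideal_gen_mult)
qed (intro forms_intros | simp add: arrangement_eq arrangement_eq(1)[unfolded One_nat_def] conic_def algebra_simps)+

lemma nearly_free_arrangement_3: "nearly_free (arrangement 3)"
proof (rule nearly_free_arrangementI[where \<kappa> = 60 and na = 1 and nb = 1 and nc = 2 and
    lam = X and \<alpha> = 1 and \<beta> = 1 and \<gamma> = 0 and
    ax = "X - 2 * Y + Z" and ay = "X - Z" and az = "X - Y" and al = "3 * (Y - X)" and
    bx = "- X - 5 * Z" and b_y = "- Y" and bz = "- Z" and bl = "15 * Z" and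
    cx = "- (27 * X * X) + 15 * X * Y - 16 * X * Z - 15 * Y * Z + 15 * Z * Z" and
    cy = "- (20 * X * X) - 7 * X * Y + 15 * X * Z - 5 * Y * Y + 4 * Y * Z + 5 * Z * Z" and
    cz = "- (20 * X * X) + 8 * X * Z + 4 * Z * Z" and
    cl = "60 * (X * X)"])
  let ?K = "ideal_gen {3 * (Y - X), 15 * Z, 60 * (X * X)}"
  have K: "3 * (Y - X) \<in> ?K" "15 * Z \<in> ?K" "60 * (X * X) \<in> ?K"
    by (rule ideal_gen_base, simp)+
  from K[THEN ideal_gen_numeral_cancel]
  show "X - const3 1 * X \<in> ?K" "Y - const3 1 * X \<in> ?K" "Z - const3 0 * X \<in> ?K" "X * X \<in> ?K"
    by (simp_all add: ring_hom_0[OF ring_hom_const3] ring_hom_1[OF ring_hom_const3] ideal_gen_0 ideal_gen_mult)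
qed (intro forms_intros | simp add: arrangement_eq arrangement_eq(1)[unfolded One_nat_def] conic_def algebra_simps)+

lemma nearly_free_arrangement_4: "nearly_free (arrangement 4)"
proof (rule nearly_free_arrangementI[where \<kappa> = 72 and na = 2 and nb = 2 and nc = 2 and
    lam = Z and \<alpha> = 0 and \<beta> = 0 and \<gamma> = 1 and
    ax = "- (3 * X * Y) - 19 * X * Z" and
    ay = "3 * Y * Y - Y * Z - 6 * Z * Z" and
    az = "- (12 * X * X) - 3 * Y * Z - Z * Z" and
    al = "24 * X" and
    bx = "X * X - 9 * Y * Z - 3 * Z * Z" and b_y = "- (2 * X * Y)" and bz = "- (6 * X * Y) - 2 * X * Z" and bl = "12 * Y" and
    cx = "X * X - 24 * Z * Z" and cy = "X * Y - 6 * X * Z" and cz = "- (17 * X * Z)" and cl = "24 * Z"])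
  let ?K = "ideal_gen {24 * X, 12 * Y, 24 * Z}"
  have K: "24 * X \<in> ?K" "12 * Y \<in> ?K" "24 * Z \<in> ?K"
    by (rule ideal_gen_base, simp)+
  from K[THEN ideal_gen_numeral_cancel]
  show "X - const3 0 * Z \<in> ?K" "Y - const3 0 * Z \<in> ?K" "Z - const3 1 * Z \<in> ?K" "Z * Z \<in> ?K"
    by (simp_all add: ring_hom_0[OF ring_hom_const3] ring_hom_1[OF ring_hom_const3] ideal_gen_0 ideal_gen_mult)
qed (intro forms_intros | simp add: arrangement_eq arrangement_eq(1)[unfolded One_nat_def] conic_def algebra_simps)+

lemma nearly_free_arrangement_5: "nearly_free (arrangement 5)"
proof (rule nearly_free_arrangementI[where \<kappa> = 392 and na = 2 and nb = 2 and nc = 3 and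
    lam = Z and \<alpha> = 0 and \<beta> = 0 and \<gamma> = 1 and
    ax = "- (8 * X * Y)" and ay = "7 * X * X + 6 * Y * Y - 14 * Z * Z" and az = "- (8 * Y * Z)" and al = "14 * X" and
    bx = "6 * X * X - 14 * Z * Z" and b_y = "- (X * Y)" and bz = "- (8 * X * Z)" and bl = "14 * Y" and
    cx = "2 * X * X * Y - 14 * Y * Z * Z" and
    cy = "2 * X * Y * Y - 7 * X * Z * Z" and
    cz = "- (12 * X * Y * Z)" and
    cl = "14 * (Z * Z)"])
  let ?K = "ideal_gen {14 * X, 14 * Y, 14 * (Z * Z)}"
  have K: "14 * X \<in> ?K" "14 * Y \<in> ?K" "14 * (Z * Z) \<in> ?K"
    by (rule ideal_gen_base, simp)+
  from K[THEN ideal_gen_numeral_cancel]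
  show "X - const3 0 * Z \<in> ?K" "Y - const3 0 * Z \<in> ?K" "Z - const3 1 * Z \<in> ?K" "Z * Z \<in> ?K"
    by (simp_all add: ring_hom_0[OF ring_hom_const3] ring_hom_1[OF ring_hom_const3] ideal_gen_0 ideal_gen_mult)
qed (intro forms_intros | simp add: arrangement_eq arrangement_eq(1)[unfolded One_nat_def] conic_def algebra_simps)+

section \<open>Local germs\<close>

text \<open>Both sides agree on monomials.\<close>
lemma ring_hom_eval3_comp:
  assumes \<iota>: "is_ring_hom \<iota>" and \<phi>: "is_ring_hom \<phi>"
  shows "\<phi> (eval3 \<iota> f a b c) = eval3 (\<lambda>z. \<phi> (\<iota> z)) f (\<phi> a) (\<phi> b) (\<phi> c)"
proof -
  have comp: "is_ring_hom (\<lambda>z. \<phi> (\<iota> z))" using \<iota> \<phi> by (simp add: is_ring_hom_def)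
  note homs = ring_hom_simps[OF ring_hom_eval3[OF \<iota>]] ring_hom_simps[OF ring_hom_eval3[OF comp]] ring_hom_simps[OF \<phi>]
    eval3_simps[OF \<iota>] eval3_simps[OF comp]
  show ?thesis by (subst (1 2) monomial_expansion[of f]) (simp only: homs)
qed

definition germ_u :: germ where "germ_u = fps_const fps_X"
definition germ_v :: germ where "germ_v = fps_X"

lemma ring_hom_germ_const: "is_ring_hom germ_const"
  by (simp add: is_ring_hom_def germ_const_def fps_const_add[symmetric] fps_const_mult[symmetric] del: fps_const_add fps_const_mult)

lemma germ_coeff_simps [simp]:
  "germ_coeff 0 i j = 0"
  "germ_coeff (g + h) i j = germ_coeff g i j + germ_coeff h i j"
  "germ_coeff (g - h) i j = germ_coeff g i j - germ_coeff h i j"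
  "germ_coeff (g * h) 0 0 = germ_coeff g 0 0 * germ_coeff h 0 0"
  "germ_coeff (g * h) (Suc 0) 0 = germ_coeff g 0 0 * germ_coeff h (Suc 0) 0 + germ_coeff g (Suc 0) 0 * germ_coeff h 0 0"
  "germ_coeff (g * h) 0 (Suc 0) = germ_coeff g 0 0 * germ_coeff h 0 (Suc 0) + germ_coeff g 0 (Suc 0) * germ_coeff h 0 0"
  "germ_coeff (germ_const c) i j = (if i = 0 \<and> j = 0 then c else 0)"
  "germ_coeff germ_u i j = (if i = 1 \<and> j = 0 then 1 else 0)"
  "germ_coeff germ_v i j = (if i = 0 \<and> j = 1 then 1 else 0)"
  by (simp_all add: germ_coeff_def germ_const_def germ_u_def germ_v_def fps_mult_nth)

lemma germ_coeff_1 [simp]: "germ_coeff 1 i j = (if i = 0 \<and> j = 0 then 1 else 0)"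
  using germ_coeff_simps(7)[of 1] ring_hom_1[OF ring_hom_germ_const] by simp

lemma ring_hom_germ_coeff_00: "is_ring_hom (\<lambda>g. germ_coeff g 0 0)"
  by (simp add: is_ring_hom_def)

lemma ring_hom_local_germ: "is_ring_hom (\<lambda>f. local_germ f p e1 e2)"
  unfolding local_germ_def Let_def by (rule ring_hom_eval3[OF ring_hom_germ_const])

lemmas local_germ_simps = ring_hom_simps[OF ring_hom_local_germ]

lemma local_germ_XYZ:
  "local_germ X p e1 e2 = germ_const (p $ 1) + germ_const (e1 $ 1) * germ_u + germ_const (e2 $ 1) * germ_v"
  "local_germ Y p e1 e2 = germ_const (p $ 2) + germ_const (e1 $ 2) * germ_u + germ_const (e2 $ 2) * germ_v"
  "local_germ Z p e1 e2 = germ_const (p $ 3) + germ_const (e1 $ 3) * germ_u + germ_const (e2 $ 3) * germ_v"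
  unfolding local_germ_def Let_def germ_u_def germ_v_def by (rule eval3_simps[OF ring_hom_germ_const])+

lemma germ_coeff_local_germ: "germ_coeff (local_germ f p e1 e2) 0 0 = value_at f p"
  unfolding local_germ_def Let_def value_at_def germ_u_def[symmetric] germ_v_def[symmetric]
  by (subst ring_hom_eval3_comp[OF ring_hom_germ_const ring_hom_germ_coeff_00]) simp

lemma germ_unit:
  assumes "germ_coeff g 0 0 \<noteq> 0"
  shows "\<exists>h. g * h = 1"
proof -
  have "fps_nth (fps_nth g 0) 0 * inverse (fps_nth (fps_nth g 0) 0) = 1"
    using assms by (simp add: germ_coeff_def)
  then have "fps_nth g 0 * fps_right_inverse (fps_nth g 0) (inverse (fps_nth (fps_nth g 0) 0)) = 1"
    by (rule fps_right_inverse)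
  then show ?thesis using fps_right_inverse by blast
qed

lemma germ_decomposition:
  "g = germ_const (germ_coeff g 0 0) + germ_const (germ_coeff g 1 0) * germ_u +
     germ_u * germ_u * fps_const (fps_shift 2 (fps_nth g 0)) + germ_v * fps_shift 1 g"
proof -
  have "g = fps_const (fps_nth g 0) + fps_X * fps_shift 1 g"
    by (rule fps_ext) (simp add: fps_X_mult_nth)
  moreover have "fps_nth g 0 = fps_const (germ_coeff g 0 0) + fps_const (germ_coeff g 1 0) * fps_X +
      fps_X * fps_X * fps_shift 2 (fps_nth g 0)"
  proof (rule fps_ext)
    fix n
    consider "n = 0" | "n = 1" | k where "n = Suc (Suc k)" by (cases n rule: nat.exhaust; metis One_nat_def nat.exhaust)
    then show "fps_nth (fps_nth g 0) n = fps_nth (fps_const (germ_coeff g 0 0) + fps_const (germ_coeff g 1 0) * fps_X +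
        fps_X * fps_X * fps_shift 2 (fps_nth g 0)) n"
      by cases (simp_all add: germ_coeff_def mult.assoc)
  qed
  ultimately show ?thesis
    unfolding germ_const_def germ_u_def germ_v_def by (metis fps_const_add fps_const_mult)
qed

text \<open>Up to units the ideal is \<open>(v, u\<^sup>2)\<close>, so \<open>1\<close> and \<open>u\<close> form a basis of the quotient.\<close>
lemma intersection_multiplicity_2:
  assumes g: "g = germ_const c * germ_v" "c \<noteq> 0"
    and h: "h = (germ_v * b + germ_u * germ_u * germ_const c') * k" "c' \<noteq> 0" "germ_coeff k 0 0 \<noteq> 0"
  shows "has_intersection_multiplicity g h 2"
proof -
  let ?W = "ideal_gen {g, h}"
  have const: "germ_const (inverse a) * germ_const a = 1" if "a \<noteq> 0" for a
    using that by (simp add: ring_hom_1[OF ring_hom_germ_const] flip: ring_hom_mult[OF ring_hom_germ_const])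
  obtain k' where k': "k * k' = 1" using germ_unit[OF h(3)] by blast
  have "germ_const (inverse c) * g \<in> ?W" by (intro ideal_gen_mult ideal_gen_base) simp
  then have v: "germ_v \<in> ?W" using const[OF g(2)] by (simp add: g(1) flip: mult.assoc)
  have "h \<in> ?W" by (rule ideal_gen_base) simp
  then have "germ_const (inverse c') * (k' * h - b * germ_v) \<in> ?W"
    by (intro ideal_gen_mult ideal_gen_diff v)
  also have "k' * h = (k * k') * (germ_v * b + germ_u * germ_u * germ_const c')" unfolding h by (simp only: ac_simps)
  also have "germ_const (inverse c') * (\<dots> - b * germ_v) = (germ_const (inverse c') * germ_const c') * (germ_u * germ_u)"
    unfolding k' by (simp add: algebra_simps)
  finally have uu: "germ_u * germ_u \<in> ?W" unfolding const[OF h(2)] by simp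
  have ne: "1 \<noteq> germ_u"
  proof
    assume "1 = germ_u"
    then have "germ_coeff 1 0 0 = germ_coeff germ_u 0 0" by (rule arg_cong)
    then show False by simp
  qed
  show ?thesis
    unfolding has_intersection_multiplicity_def has_quotient_dim_def
  proof (intro exI[of _ "{1, germ_u}"] conjI allI impI ballI)
    show "finite {1, germ_u}" "{1, germ_u} \<subseteq> UNIV" "card {1, germ_u} = 2" using ne by simp_all
    fix a x assume W: "(\<Sum>x\<in>{1, germ_u}. germ_const (a x) * x) \<in> ?W" and x: "x \<in> {1, germ_u}"
    then obtain r s where eq: "germ_const (a 1) + germ_const (a germ_u) * germ_u = r * g + s * h"
      using ne by (auto simp: in_ideal_gen2)
    from arg_cong[OF eq, of "\<lambda>g. germ_coeff g 0 0"] have "a 1 = 0" by (simp add: g h)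
    moreover from arg_cong[OF eq, of "\<lambda>g. germ_coeff g 1 0"] have "a germ_u = 0" by (simp add: g h)
    ultimately show "a x = 0" using x by auto
  next
    fix w :: germ
    let ?a = "\<lambda>x. if x = 1 then germ_coeff w 0 0 else germ_coeff w 1 0"
    have "w - (\<Sum>x\<in>{1, germ_u}. germ_const (?a x) * x) =
        fps_const (fps_shift 2 (fps_nth w 0)) * (germ_u * germ_u) + fps_shift 1 w * germ_v"
      using ne by (subst germ_decomposition[of w]) (simp add: algebra_simps)
    also have "\<dots> \<in> ?W" by (intro ideal_gen_add ideal_gen_mult uu v)
    finally show "\<exists>a. w - (\<Sum>x\<in>{1, germ_u}. germ_const (a x) * x) \<in> ?W" by (rule exI[where x = ?a])
  qed
qed

lemma distinct_tangents_unit: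
  assumes "germ_coeff h 0 0 = 0" "germ_coeff k 0 0 \<noteq> 0"
  shows "distinct_tangents g (h * k) \<longleftrightarrow> distinct_tangents g h"
  using assms by (simp add: distinct_tangents_def)

lemma smooth_branch_unit:
  assumes "germ_coeff k 0 0 \<noteq> 0" "smooth_branch h"
  shows "smooth_branch (h * k)"
  using assms by (simp add: smooth_branch_def)

lemma smooth_branchI:
  assumes "value_at f p = 0" "distinct_tangents (local_germ f p e1 e2) g \<or> distinct_tangents g (local_germ f p e1 e2)"
  shows "smooth_branch (local_germ f p e1 e2)"
  using assms by (auto simp: smooth_branch_def germ_coeff_local_germ distinct_tangents_def)

text \<open>The chart is chosen along the line \<open>l\<close>, whose germ is then the coordinate \<open>v\<close>. The components that avoid
  the point form a unit \<open>k\<close>, which is absorbed into one branch.\<close>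
lemma tacnodeI:
  assumes det: "det (vector [p, e1, e2] :: complex^3^3) \<noteq> 0"
    and f: "f = l * q * k" and k: "value_at k p \<noteq> 0"
    and l: "local_germ l p e1 e2 = germ_v"
    and q: "local_germ q p e1 e2 = germ_v * b + germ_u * germ_u" and b: "germ_coeff b 0 0 \<noteq> 0"
  shows "tacnode f p"
proof -
  let ?k = "local_germ k p e1 e2"
  have k0: "germ_coeff ?k 0 0 \<noteq> 0" using k by (simp add: germ_coeff_local_germ)
  have "local_germ f p e1 e2 = germ_v * ((germ_v * b + germ_u * germ_u) * ?k)"
    by (simp add: f local_germ_simps l q mult.assoc)
  moreover have "smooth_branch germ_v" by (simp add: smooth_branch_def)
  moreover have "smooth_branch ((germ_v * b + germ_u * germ_u) * ?k)"
    using k0 b by (intro smooth_branch_unit) (simp_all add: smooth_branch_def)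
  moreover have "has_intersection_multiplicity germ_v ((germ_v * b + germ_u * germ_u) * ?k) 2"
    by (rule intersection_multiplicity_2[of _ 1 _ b 1 ?k]) (simp_all add: k0 ring_hom_1[OF ring_hom_germ_const])
  ultimately show ?thesis
    unfolding tacnode_def germ_at_def tacnode_germ_def using det by blast
qed

text \<open>\<open>V\<close> indexes the components through \<open>p\<close>; the product of the others is a local unit. A single smooth
  component gives a smooth point of the curve, so a singular point has two or three branches.\<close>
lemma transversal_components:
  fixes C :: "nat \<Rightarrow> poly3"
  assumes S: "finite S" and f: "f = (\<Prod>i\<in>S. C i)" and sing: "singular_point f p"
    and det: "det (vector [p, e1, e2] :: complex^3^3) \<noteq> 0"
    and V: "V = {i\<in>S. value_at (C i) p = 0}" and card: "card V \<le> 3"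
    and smooth: "\<And>i. i \<in> V \<Longrightarrow> value_at (dx (C i)) p \<noteq> 0 \<or> value_at (dy (C i)) p \<noteq> 0 \<or> value_at (dz (C i)) p \<noteq> 0"
    and tangents: "\<And>i j. i \<in> V \<Longrightarrow> j \<in> V \<Longrightarrow> i \<noteq> j \<Longrightarrow> distinct_tangents (local_germ (C i) p e1 e2) (local_germ (C j) p e1 e2)"
  shows "node f p \<or> ordinary_triple_point f p"
proof -
  define k where "k = (\<Prod>i\<in>S - V. C i)"
  let ?g = "\<lambda>i. local_germ (C i) p e1 e2" and ?k = "local_germ k p e1 e2"
  have k: "value_at k p \<noteq> 0" using S V by (simp add: k_def)
  then have k0: "germ_coeff ?k 0 0 \<noteq> 0" by (simp add: germ_coeff_local_germ)
  have fk: "f = (\<Prod>i\<in>V. C i) * k"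
    unfolding f k_def using prod.subset_diff[of V S C] S V by (simp add: mult.commute)
  have zero: "value_at (C i) p = 0" if "i \<in> V" for i using that V by simp
  have finV: "finite V" using S V by simp
  have "card V \<noteq> 0"
  proof
    assume "card V = 0"
    then have "f = k" using finV fk by simp
    then show False using sing k by (simp add: singular_point_def curve_def)
  qed
  moreover have "card V \<noteq> 1"
  proof
    assume "card V = 1"
    then obtain i where i: "V = {i}" by (rule card_1_singletonE)
    then have "f = C i * k" using fk by simp
    then show False using sing k zero[of i] smooth[of i] i by (simp add: singular_point_def)
  qed
  ultimately consider "card V = 2" | "card V = 3" using card by linarith
  then show ?thesis
  proof cases
    case 1
    then obtain i j where ij: "V = {i, j}" "i \<noteq> j" by (auto simp: card_2_iff)
    have t: "distinct_tangents (?g i) (?g j)" using tangents ij by simp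
    have "local_germ f p e1 e2 = ?g i * (?g j * ?k)"
      using fk ij by (simp add: local_germ_simps mult.assoc)
    moreover have "smooth_branch (?g i)" using zero ij t by (intro smooth_branchI) auto
    moreover have "smooth_branch (?g j * ?k)" using zero ij t by (intro smooth_branch_unit k0 smooth_branchI) auto
    moreover have "distinct_tangents (?g i) (?g j * ?k)"
      using t zero ij k0 by (simp add: distinct_tangents_unit germ_coeff_local_germ)
    ultimately have "node f p" unfolding node_def germ_at_def node_germ_def using det by blast
    then show ?thesis ..
  next
    case 2
    then obtain i j l where ijl: "V = {i, j, l}" "i \<noteq> j" "i \<noteq> l" "j \<noteq> l" by (auto simp: card_3_iff)
    have t: "distinct_tangents (?g i) (?g j)" "distinct_tangents (?g i) (?g l)" "distinct_tangents (?g j) (?g l)"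
      using tangents ijl by simp_all
    have "local_germ f p e1 e2 = ?g i * ?g j * (?g l * ?k)"
      using fk ijl by (simp add: local_germ_simps mult.assoc)
    moreover have "smooth_branch (?g i)" "smooth_branch (?g j)" using zero ijl t by (auto intro!: smooth_branchI)
    moreover have "smooth_branch (?g l * ?k)" using zero ijl t by (intro smooth_branch_unit k0 smooth_branchI) auto
    moreover have "distinct_tangents (?g i) (?g l * ?k)" "distinct_tangents (?g j) (?g l * ?k)"
      using t zero ijl k0 by (simp_all add: distinct_tangents_unit germ_coeff_local_germ)
    ultimately have "ordinary_triple_point f p"
      unfolding ordinary_triple_point_def germ_at_def triple_point_germ_def using det t(1) by blast
    then show ?thesis ..
  qed
qed

section \<open>The singular points of the arrangements\<close>

definition component :: "nat \<Rightarrow> poly3" where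
  "component i = (if i < 5 then lines ! i else conic)"

lemma arrangement_eq_prod_component:
  assumes "d \<le> 5"
  shows "arrangement d = (\<Prod>i\<in>insert 5 {..<d}. component i)"
proof -
  have "(\<Prod>i\<in>insert 5 {..<d}. component i) = component 5 * (\<Prod>i<d. component i)"
    using assms by (subst prod.insert) auto
  also have "(\<Prod>i<d. component i) = (\<Prod>i<d. lines ! i)"
    using assms by (intro prod.cong) (auto simp: component_def)
  finally show ?thesis by (simp add: component_def arrangement_def mult.commute)
qed

lemma component_simps [simp]:
  "component 0 = Z" "component 1 = X - Z" "component (Suc 0) = X - Z" "component 2 = Y - Z" "component 3 = X + Z"
  "component 4 = Y + Z" "component 5 = X * X + Y * Y - Z * Z"
  by (simp_all add: component_def conic_def)

lemma det_vector_3: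
  "det (vector [vector [a, b, c], vector [d, e, f], vector [g, h, i]] :: complex^3^3) =
    a * (e * i - f * h) - b * (d * i - f * g) + c * (d * h - e * g)"
  by (simp add: det_3 algebra_simps)

lemma vec3_cases:
  obtains a b c where "p = (vector [a, b, c] :: complex^3)"
proof
  show "p = vector [p $ 1, p $ 2, p $ 3]" by (simp add: vec_eq_iff forall_3)
qed

lemma vec3_eq_0: "vector [a, b, c] = (0 :: complex^3) \<longleftrightarrow> a = 0 \<and> b = 0 \<and> c = 0"
  by (simp add: vec_eq_iff forall_3)

lemma component_smooth:
  assumes "p \<noteq> 0" "i < 6"
  shows "value_at (dx (component i)) p \<noteq> 0 \<or> value_at (dy (component i)) p \<noteq> 0 \<or> value_at (dz (component i)) p \<noteq> 0"
proof -
  obtain a b c where p: "p = vector [a, b, c]" by (rule vec3_cases)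
  have "i < 5 \<or> i = 5" using assms(2) by auto
  then show ?thesis using assms(1) by (auto simp: less_5 vec3_eq_0 p)
qed

text \<open>At a point with \<open>z = 0\<close> the components through it are among the line at infinity and a pair of parallel
  lines, or are the line at infinity and the conic, always with distinct tangents. Elsewhere at most one
  line of each parallel pair passes through the point. If the conic does too, then the line is its
  tangent and no other line passes through the point; otherwise two lines cross.\<close>
lemma singular_points:
  assumes d: "d \<le> 5" and sing: "singular_point (arrangement d) p"
  shows "node (arrangement d) p \<or> tacnode (arrangement d) p \<or> ordinary_triple_point (arrangement d) p"
proof -
  define S where "S = insert 5 {..<d}"
  define V where "V = {i\<in>S. value_at (component i) p = 0}"
  have S: "finite S" "S \<subseteq> {0, 1, 2, 3, 4, 5}" using d by (auto simp: S_def)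
  have V_index: "i \<in> {0, 1, 2, 3, 4, 5}" and V_val: "value_at (component i) p = 0" if "i \<in> V" for i
    using S that by (auto simp: V_def)
  have V_subI: "V \<subseteq> T"
    if "\<And>r. r \<in> {0, 1, 2, 3, 4, 5} \<Longrightarrow> value_at (component r) p = 0 \<Longrightarrow> r \<in> T" for T
    using that V_index V_val by blast
  have f: "arrangement d = (\<Prod>i\<in>S. component i)" unfolding S_def by (rule arrangement_eq_prod_component[OF d])
  have p: "p \<noteq> 0" using sing by (simp add: singular_point_def curve_def)
  obtain a b c where abc: "p = vector [a, b, c]" by (rule vec3_cases)
  have nz: "a \<noteq> 0 \<or> b \<noteq> 0 \<or> c \<noteq> 0" using p by (auto simp: vec3_eq_0 abc)
  let ?g = "\<lambda>i e1 e2. local_germ (component i) p e1 e2"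
  have transversal: "node (arrangement d) p \<or> ordinary_triple_point (arrangement d) p"
    if V_ijk: "V \<subseteq> {i, j, k}" and det: "det (vector [p, e1, e2] :: complex^3^3) \<noteq> 0"
      and ij: "i \<in> V \<Longrightarrow> j \<in> V \<Longrightarrow> i \<noteq> j \<Longrightarrow> distinct_tangents (?g i e1 e2) (?g j e1 e2)"
      and ik: "i \<in> V \<Longrightarrow> k \<in> V \<Longrightarrow> i \<noteq> k \<Longrightarrow> distinct_tangents (?g i e1 e2) (?g k e1 e2)"
      and jk: "j \<in> V \<Longrightarrow> k \<in> V \<Longrightarrow> j \<noteq> k \<Longrightarrow> distinct_tangents (?g j e1 e2) (?g k e1 e2)"
    for e1 e2 i j k
  proof (rule transversal_components[OF S(1) f sing det V_def])
    have sym: "distinct_tangents h g" if "distinct_tangents g h" for g h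
      using that by (auto simp: distinct_tangents_def mult.commute)
    show "distinct_tangents (?g r e1 e2) (?g s e1 e2)" if "r \<in> V" "s \<in> V" "r \<noteq> s" for r s
    proof -
      have "r = i \<or> r = j \<or> r = k" "s = i \<or> s = j \<or> s = k" using V_ijk that by auto
      then show ?thesis using that ij ik jk sym by metis
    qed
    have "card V \<le> card {i, j, k}" using V_ijk by (intro card_mono) auto
    also have "\<dots> \<le> 3" by (simp add: card_insert_if)
    finally show "card V \<le> 3" .
    show "value_at (dx (component i)) p \<noteq> 0 \<or> value_at (dy (component i)) p \<noteq> 0 \<or> value_at (dz (component i)) p \<noteq> 0"
      if "i \<in> V" for i
      using V_index[OF that] that by (intro component_smooth[OF p]) auto
  qed
  have tacnode: "tacnode (arrangement d) p"
    if "det (vector [p, e1, e2] :: complex^3^3) \<noteq> 0" and V: "V = {i, 5}" "i \<noteq> 5"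
      and "local_germ (component i) p e1 e2 = germ_v"
      and "local_germ (component 5) p e1 e2 = germ_v * g + germ_u * germ_u" and "germ_coeff g 0 0 \<noteq> 0"
    for e1 e2 i g
  proof (rule tacnodeI[OF that(1) _ _ that(4-6)])
    have "V \<subseteq> S" by (auto simp: V_def)
    then show "arrangement d = component i * component 5 * (\<Prod>i\<in>S - V. component i)"
      using prod.subset_diff[of V S component] S(1) V by (simp add: f mult.commute)
    show "value_at (\<Prod>i\<in>S - V. component i) p \<noteq> 0" using S(1) by (simp add: V_def)
  qed
  note gc = ring_hom_0[OF ring_hom_germ_const] ring_hom_1[OF ring_hom_germ_const]
    ring_hom_minus[OF ring_hom_germ_const]
  note germs = local_germ_simps local_germ_XYZ abc distinct_tangents_def gc
  show ?thesis
  proof (cases "c = 0")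
    case True
    consider "a = 0" "b \<noteq> 0" | "a \<noteq> 0" "b = 0" | "a \<noteq> 0" "b \<noteq> 0" using nz True by blast
    then show ?thesis
    proof cases
      case 1
      have V: "V \<subseteq> {0, 1, 3}"
        by (rule V_subI) (use 1 True in \<open>auto simp: abc\<close>)
      have "node (arrangement d) p \<or> ordinary_triple_point (arrangement d) p"
        by (rule transversal[OF V, of "vector [1, 0, 0]" "vector [0, 0, 1]"])
          (use 1 True in \<open>auto simp: germs det_vector_3\<close>)
      then show ?thesis by blast
    next
      case 2
      have V: "V \<subseteq> {0, 2, 4}"
        by (rule V_subI) (use 2 True in \<open>auto simp: abc\<close>)
      have "node (arrangement d) p \<or> ordinary_triple_point (arrangement d) p"
        by (rule transversal[OF V, of "vector [0, 1, 0]" "vector [0, 0, 1]"])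
          (use 2 True in \<open>auto simp: germs det_vector_3\<close>)
      then show ?thesis by blast
    next
      case 3
      have V: "V \<subseteq> {0, 5, 5}"
        by (rule V_subI) (use 3 True in \<open>auto simp: abc\<close>)
      have "node (arrangement d) p \<or> ordinary_triple_point (arrangement d) p"
        by (rule transversal[OF V, of "vector [0, 1, 0]" "vector [0, 0, 1]"])
          (use 3 True in \<open>auto simp: germs det_vector_3\<close>)
      then show ?thesis by blast
    qed
  next
    case False
    note c = this
    show ?thesis
    proof (cases "5 \<in> V \<and> V \<noteq> {5}")
      case True
      then obtain j where j: "j \<in> V" "j \<noteq> 5" and 5: "5 \<in> V" by blast
      have circle: "a * a + b * b = c * c" using V_val[OF 5] by (simp add: abc)
      have "j = 1 \<or> j = 2 \<or> j = 3 \<or> j = 4"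
        using V_index[OF j(1)] V_val[OF j(1)] j c by (auto simp: abc)
      then consider "j = 1 \<and> a = c \<or> j = 3 \<and> a = - c" | "j = 2 \<and> b = c \<or> j = 4 \<and> b = - c"
        using V_val[OF j(1)] by (auto simp: abc eq_neg_iff_add_eq_0)
      then have "tacnode (arrangement d) p"
      proof cases
        case 1
        then have b: "b = 0" using circle by auto
        have V: "V = {j, 5}"
        proof
          show "V \<subseteq> {j, 5}" by (rule V_subI) (use 1 c in \<open>auto simp: abc b\<close>)
        qed (use j 5 in blast)
        have square: "germ_const a * germ_const a = germ_const c * germ_const c"
          using 1 by (auto simp: gc)
        show ?thesis
        proof (rule tacnode[OF _ V j(2)])
          show "det (vector [p, vector [0, 1, 0], vector [1, 0, 0]] :: complex^3^3) \<noteq> 0"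
            using c by (simp add: abc det_vector_3)
          show "local_germ (component j) p (vector [0, 1, 0]) (vector [1, 0, 0]) = germ_v"
            using 1 by (elim disjE conjE) (simp_all add: germs)
          have "local_germ (component 5) p (vector [0, 1, 0]) (vector [1, 0, 0]) =
              (germ_const a + germ_v) * (germ_const a + germ_v) + germ_u * germ_u - germ_const c * germ_const c"
            by (simp add: germs b)
          also have "\<dots> = germ_v * (germ_const a + germ_const a + germ_v) + germ_u * germ_u"
            unfolding square[symmetric] by (simp add: algebra_simps)
          finally show "local_germ (component 5) p (vector [0, 1, 0]) (vector [1, 0, 0]) =
              germ_v * (germ_const a + germ_const a + germ_v) + germ_u * germ_u" .
          show "germ_coeff (germ_const a + germ_const a + germ_v) 0 0 \<noteq> 0"
            using 1 c by (elim disjE conjE) (simp_all add: ring_hom_numeral[OF ring_hom_germ_coeff_00])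
        qed
      next
        case 2
        then have a: "a = 0" using circle by auto
        have V: "V = {j, 5}"
        proof
          show "V \<subseteq> {j, 5}" by (rule V_subI) (use 2 c in \<open>auto simp: abc a\<close>)
        qed (use j 5 in blast)
        have square: "germ_const b * germ_const b = germ_const c * germ_const c"
          using 2 by (auto simp: gc)
        show ?thesis
        proof (rule tacnode[OF _ V j(2)])
          show "det (vector [p, vector [1, 0, 0], vector [0, 1, 0]] :: complex^3^3) \<noteq> 0"
            using c by (simp add: abc det_vector_3)
          show "local_germ (component j) p (vector [1, 0, 0]) (vector [0, 1, 0]) = germ_v"
            using 2 by (elim disjE conjE) (simp_all add: germs)
          have "local_germ (component 5) p (vector [1, 0, 0]) (vector [0, 1, 0]) =
              germ_u * germ_u + (germ_const b + germ_v) * (germ_const b + germ_v) - germ_const c * germ_const c"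
            by (simp add: germs a)
          also have "\<dots> = germ_v * (germ_const b + germ_const b + germ_v) + germ_u * germ_u"
            unfolding square[symmetric] by (simp add: algebra_simps)
          finally show "local_germ (component 5) p (vector [1, 0, 0]) (vector [0, 1, 0]) =
              germ_v * (germ_const b + germ_const b + germ_v) + germ_u * germ_u" .
          show "germ_coeff (germ_const b + germ_const b + germ_v) 0 0 \<noteq> 0"
            using 2 c by (elim disjE conjE) (simp_all add: ring_hom_numeral[OF ring_hom_germ_coeff_00])
        qed
      qed
      then show ?thesis by blast
    next
      case False
      have V: "V \<subseteq> {if a = c then 1 else 3, if b = c then 2 else 4, 5}"
        by (rule V_subI) (use c in \<open>auto simp: abc eq_neg_iff_add_eq_0\<close>)
      have "node (arrangement d) p \<or> ordinary_triple_point (arrangement d) p"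
        by (rule transversal[OF V, of "vector [1, 0, 0]" "vector [0, 1, 0]"])
          (use False c in \<open>auto simp: germs det_vector_3 split: if_splits\<close>)
      then show ?thesis by blast
    qed
  qed
qed

section \<open>Existence in degrees three to seven\<close>

lemma smooth_conic_form_conic: "smooth_conic_form conic"
proof -
  have "\<not> singular_point conic p" for p
  proof -
    obtain a b c where p: "p = vector [a, b, c]" by (rule vec3_cases)
    show ?thesis by (auto simp: singular_point_def curve_def conic_def p vec3_eq_0)
  qed
  then show ?thesis
    using conic_form irreducible_conic by (auto simp: smooth_conic_form_def)
qed

lemma conic_line_arrangement_arrangement:
  assumes d: "d \<le> 5"
  shows "conic_line_arrangement d 1 (arrangement d)"
  unfolding conic_line_arrangement_def
proof (rule exI[of _ "\<lambda>i. lines ! i"], rule exI[of _ "\<lambda>_. conic"], intro conjI allI impI)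
  show "line_form (lines ! i)" if "i < d" for i
    using that d prime_elem_line[of i] lines_form[of i] by (auto simp: line_form_def prime_elem_def)
  show "inj_on (\<lambda>i. curve (lines ! i)) {..<d}"
  proof (rule inj_onI)
    fix i j assume ij: "i \<in> {..<d}" "j \<in> {..<d}" and eq: "curve (lines ! i) = curve (lines ! j)"
    have "line_point i \<noteq> 0" using ij d less_5[of i] by (auto simp: line_point_def vec3_eq_0)
    then have "line_point i \<in> curve (lines ! i)"
      using ij d by (simp add: curve_def value_at_line_point)
    then have "line_point i \<in> curve (lines ! j)" by (simp only: eq)
    then show "i = j" using ij d by (simp add: curve_def value_at_line_point)
  qed
  show "smooth_conic_form conic" by (rule smooth_conic_form_conic)
  show "inj_on (\<lambda>j. curve conic) {..<1::nat}" by (rule inj_onI) simp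
  show "arrangement d = (\<Prod>i<d. lines ! i) * (\<Prod>j<1::nat. conic)"
    by (simp add: arrangement_def)
qed

theorem mainTheorem5:
  fixes m :: nat
  assumes "m \<in> {3, 4, 5, 6, 7}"
  shows "\<exists>d k f. d \<ge> 1 \<and> k \<ge> 1 \<and> 2 * k + d = m \<and>
    conic_line_arrangement d k f \<and> nearly_free f \<and>
    (\<forall>p. singular_point f p \<longrightarrow> node f p \<or> tacnode f p \<or> ordinary_triple_point f p)"
proof -
  obtain d where d: "d \<in> {1, 2, 3, 4, 5}" and m: "2 * 1 + d = m"
    using assms by (intro that[of "m - 2"]) auto
  have d_bounds: "1 \<le> d" "d \<le> 5" using d by auto
  have "nearly_free (arrangement d)"
    using d nearly_free_arrangement_1 nearly_free_arrangement_2 nearly_free_arrangement_3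
      nearly_free_arrangement_4 nearly_free_arrangement_5 by blast
  then have "1 \<le> d \<and> 1 \<le> (1::nat) \<and> 2 * 1 + d = m \<and>
      conic_line_arrangement d 1 (arrangement d) \<and> nearly_free (arrangement d) \<and>
      (\<forall>p. singular_point (arrangement d) p \<longrightarrow>
        node (arrangement d) p \<or> tacnode (arrangement d) p \<or> ordinary_triple_point (arrangement d) p)"
    using d_bounds m conic_line_arrangement_arrangement[OF d_bounds(2)] singular_points[OF d_bounds(2)]
    by (intro conjI allI impI order_refl)
  then show ?thesis by blast
qed

end
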